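(* For all $\lambda$ with $0\le\lambda<\frac{2}{\sqrt{3}}-1$, $\bar{\delta}_2(\lambda)=\bar{\sigma}_2(\lambda)$.
   Context: $\mathbb{E}^2$ is the Euclidean plane and $\mathbf{B}^2$ its closed unit disk centered at the origin. An infinite packing of unit disks is a family $\mathcal{P}=\{\mathbf{c}_i+\mathbf{B}^2 : i=1,2,\dots\}$ with $\|\mathbf{c}_j-\mathbf{c}_k\|\ge 2$ for all $1\le j<k$. For $\lambda\ge 0$ let $\mathbf{P}_\lambda:=\bigcup_{i=1}^{+\infty}(\mathbf{c}_i+(1+\lambda)\mathbf{B}^2)$, and let $$\bar{\delta}_2(\mathbf{P}_\lambda):=\limsup_{R\to+\infty}\frac{\mathrm{area}(\mathbf{P}_\lambda\cap R\mathbf{B}^2)}{\mathrm{area}(R\mathbf{B}^2)},\qquad \bar{\delta}_2(\lambda):=\sup_{\mathcal{P}}\bar{\delta}_2(\mathbf{P}_\lambda),$$ the supremum being over all infinite packings $\mathcal{P}$ of unit disks. Let $\mathbf{T}^2=\mathrm{conv}\{\mathbf{t}_1,\mathbf{t}_2,\mathbf{t}_3\}$ be a regular triangle of edge length $2$ in $\mathbb{E}^2$; then $$\bar{\sigma}_2(\lambda):=\frac{\mathrm{area}\left(\mathbf{T}^2\cap\bigcup_{i=1}^{3}(\mathbf{t}_i+(1+\lambda)\mathbf{B}^2)\right)}{\mathrm{area}(\mathbf{T}^2)}.$$ *)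

theory Defs
  imports "HOL-Analysis.Analysis"
begin

abbreviation area :: "(real^2) set \<Rightarrow> real" where
  "area \<equiv> measure lebesgue"

text \<open>An infinite packing of unit disks, represented by the sequence of its disk centers.\<close>

definition unit_disk_packing :: "(nat \<Rightarrow> real^2) \<Rightarrow> bool" where
  "unit_disk_packing c \<longleftrightarrow> (\<forall>j k. j < k \<longrightarrow> 2 \<le> norm (c j - c k))"

definition enlarged_union :: "(nat \<Rightarrow> real^2) \<Rightarrow> real \<Rightarrow> (real^2) set" where
  "enlarged_union c l = (\<Union>i. cball (c i) (1 + l))"

text \<open>The upper limit and the supremum are formed in the complete lattice \<open>ereal\<close>, since
  \<open>Limsup\<close> is not available on \<open>real\<close> and \<open>SUP\<close> on \<open>real\<close> is meaningful only for
  bounded nonempty families.\<close>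

definition upper_density :: "(real^2) set \<Rightarrow> ereal" where
  "upper_density S =
     Limsup at_top (\<lambda>R::real. ereal (area (S \<inter> cball 0 R) / area (cball 0 R)))"

definition delta_bar :: "real \<Rightarrow> ereal" where
  "delta_bar l = (SUP c\<in>{c. unit_disk_packing c}. upper_density (enlarged_union c l))"

definition regular_triangle2 :: "real^2 \<Rightarrow> real^2 \<Rightarrow> real^2 \<Rightarrow> bool" where
  "regular_triangle2 t1 t2 t3 \<longleftrightarrow> dist t1 t2 = 2 \<and> dist t2 t3 = 2 \<and> dist t3 t1 = 2"

definition sigma_bar :: "real^2 \<Rightarrow> real^2 \<Rightarrow> real^2 \<Rightarrow> real \<Rightarrow> real" where
  "sigma_bar t1 t2 t3 l =
     area (convex hull {t1, t2, t3} \<inter> (\<Union>t\<in>{t1, t2, t3}. cball t (1 + l)))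
       / area (convex hull {t1, t2, t3})"

end

theory Submission
  imports Defs
begin

text \<open>
  The circumradius of a regular triangle of edge length 2 is \<open>\<rho> = 2 / sqrt 3\<close>, and no disk of smaller
  radius contains three points at pairwise distance at least 2. So the bisectors of a center \<open>0\<close> and
  the other centers cut disjoint caps off the open disk \<open>ball 0 \<rho>\<close>, and the cones over these caps are
  disjoint as well. Outside the cones, the Voronoi cell truncated to \<open>ball 0 \<rho>\<close> is a conic set, in
  which \<open>cball 0 (1 + \<lambda>)\<close> has density \<open>((1 + \<lambda>) / \<rho>)\<^sup>2\<close>. Inside a cone it consists of two right
  triangles with hypotenuse \<open>\<rho>\<close> and a leg of length at least 1 at \<open>0\<close>. As in Rogers' bound, the linear
  map to such a triangle from the one with leg 1 does not decrease norms, so the density of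
  \<open>cball 0 (1 + \<lambda>)\<close> is largest for leg 1. Six triangles with leg 1 make up the regular triangle, hence
  this largest density is \<open>\<sigma>\<close>, and every truncated cell has density at most \<open>\<sigma>\<close>. Equality is
  attained by the lattice packing, whose fundamental parallelogram is made of two regular triangles.
\<close>

section \<open>Right triangles\<close>

lemma measure_le_of_negligible_diff:
  fixes S :: "'a::euclidean_space set"
  assumes "S \<in> sets lebesgue" "A \<in> lmeasurable" "negligible (S - A)"
  shows "measure lebesgue S \<le> measure lebesgue A"
proof -
  have eq: "A \<union> S = A \<union> (S - A)" by blast
  have "measure lebesgue (A \<union> (S - A)) = measure lebesgue A"
    using assms by (intro measure_negligible_symdiff) (auto intro: negligible_subset)
  moreover have "A \<union> S \<in> lmeasurable"
    unfolding eq using assms negligible_iff_measure by (intro fmeasurable.Un) auto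
  then have "measure lebesgue S \<le> measure lebesgue (A \<union> S)"
    using assms by (intro measure_mono_fmeasurable) auto
  ultimately show ?thesis unfolding eq by simp
qed

lemma measure_Un_disjoint:
  assumes "A \<in> fmeasurable M" "B \<in> fmeasurable M" "A \<inter> B = {}"
  shows "measure M (A \<union> B) = measure M A + measure M B"
  unfolding measure_Un3[OF assms(1,2)] assms(3) by simp

text \<open>The residual \<open>y\<close> is orthogonal to \<open>p\<close> and \<open>w\<close>.
  Their determinant is nonzero, since its square is \<open>(p \<bullet> p) * (w \<bullet> w)\<close>
  by Lagrange's identity, so Cramer's rule gives \<open>y = 0\<close>.\<close>

lemma orthogonal_expansion_plane:
  fixes p w x :: "real^2"
  assumes "p \<bullet> w = 0" "p \<noteq> 0" "w \<noteq> 0"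
  shows "x = (x \<bullet> p / (p \<bullet> p)) *\<^sub>R p + (x \<bullet> w / (w \<bullet> w)) *\<^sub>R w"
proof -
  define y where "y = x - ((x \<bullet> p / (p \<bullet> p)) *\<^sub>R p + (x \<bullet> w / (w \<bullet> w)) *\<^sub>R w)"
  have yp: "y \<bullet> p = 0" and yw: "y \<bullet> w = 0"
    using assms inner_commute[of w p] by (auto simp: y_def inner_diff_left inner_add_left)
  have pw: "p$1 * w$1 + p$2 * w$2 = 0"
    using assms(1) by (simp add: inner_vec_def sum_2)
  have "(p$1 * w$2 - p$2 * w$1)\<^sup>2 = (p \<bullet> p) * (w \<bullet> w) - (p$1 * w$1 + p$2 * w$2)\<^sup>2"
    by (simp add: inner_vec_def sum_2) algebra
  then have D: "p$1 * w$2 - p$2 * w$1 \<noteq> 0" using assms pw by auto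
  have "y$1 * (p$1 * w$2 - p$2 * w$1) = (y \<bullet> p) * w$2 - (y \<bullet> w) * p$2"
       "y$2 * (p$1 * w$2 - p$2 * w$1) = (y \<bullet> w) * p$1 - (y \<bullet> p) * w$1"
    by (simp_all add: inner_vec_def sum_2 algebra_simps)
  then have "y = 0" using yp yw D by (simp add: vec_eq_iff forall_2)
  then show ?thesis by (simp add: y_def)
qed

lemma inner_self_orthogonal_plane:
  fixes p w x :: "real^2"
  assumes "p \<bullet> w = 0" "p \<noteq> 0" "w \<noteq> 0"
  shows "x \<bullet> x = (x \<bullet> p / (p \<bullet> p))\<^sup>2 * (p \<bullet> p) + (x \<bullet> w / (w \<bullet> w))\<^sup>2 * (w \<bullet> w)"
proof -
  have "x \<bullet> x = x \<bullet> ((x \<bullet> p / (p \<bullet> p)) *\<^sub>R p + (x \<bullet> w / (w \<bullet> w)) *\<^sub>R w)"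
    using orthogonal_expansion_plane[OF assms] by metis
  then show ?thesis using assms
    by (simp add: inner_add_right power2_eq_square)
qed

text \<open>For \<open>p \<bullet> w = 0\<close> this is the open right triangle with vertices \<open>0\<close>, \<open>p\<close>, \<open>p + w\<close>.\<close>

definition rtri :: "real^2 \<Rightarrow> real^2 \<Rightarrow> (real^2) set" where
  "rtri p w = {x. 0 < x \<bullet> w / (w \<bullet> w) \<and> x \<bullet> w / (w \<bullet> w) < x \<bullet> p / (p \<bullet> p) \<and> x \<bullet> p / (p \<bullet> p) < 1}"

lemma norm_less_rtri:
  assumes "p \<bullet> w = 0" "p \<noteq> 0" "w \<noteq> 0" "x \<in> rtri p w"
  shows "norm x < sqrt (p \<bullet> p + w \<bullet> w)"
proof -
  define s t where "s = x \<bullet> p / (p \<bullet> p)" and "t = x \<bullet> w / (w \<bullet> w)"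
  have st: "0 < t" "t < s" "s < 1" using assms(4) by (auto simp: rtri_def s_def t_def)
  have xx: "x \<bullet> x = s\<^sup>2 * (p \<bullet> p) + t\<^sup>2 * (w \<bullet> w)"
    unfolding s_def t_def by (rule inner_self_orthogonal_plane[OF assms(1-3)])
  have "s\<^sup>2 < 1" "t\<^sup>2 < 1" using st by (simp_all add: abs_square_less_1)
  then have "s\<^sup>2 * (p \<bullet> p) < 1 * (p \<bullet> p)" "t\<^sup>2 * (w \<bullet> w) < 1 * (w \<bullet> w)"
    using assms(2,3) by (intro mult_strict_right_mono; simp)+
  then show ?thesis unfolding norm_eq_sqrt_inner xx by simp
qed

lemma open_rtri: "open (rtri p w)"
  unfolding rtri_def divide_inverse
  by (intro open_Collect_conj open_Collect_less continuous_intros)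

lemma lmeasurable_rtri:
  assumes "p \<bullet> w = 0" "p \<noteq> 0" "w \<noteq> 0"
  shows "rtri p w \<in> lmeasurable"
proof -
  have "bounded (rtri p w)"
    using norm_less_rtri[OF assms] by (intro boundedI[of _ "sqrt (p \<bullet> p + w \<bullet> w)"]) force
  then show ?thesis by (rule lmeasurable_open) (rule open_rtri)
qed

lemma lmeasurable_rtri_Int:
  assumes "p \<bullet> w = 0" "p \<noteq> 0" "w \<noteq> 0"
  shows "rtri p w \<inter> cball 0 r \<in> lmeasurable"
  by (intro fmeasurable.Int lmeasurable_rtri assms) simp

text \<open>The linear map \<open>p \<mapsto> p'\<close>, \<open>w \<mapsto> w'\<close> takes one triangle to the other and, the hypotenuses being
  equal, does not decrease the norm of any of its points.\<close>

lemma rtri_density_antimono: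
  assumes o: "p \<bullet> w = 0" "p \<noteq> 0" "w \<noteq> 0" and o': "p' \<bullet> w' = 0" "p' \<noteq> 0" "w' \<noteq> 0"
    and hyp: "p \<bullet> p + w \<bullet> w = p' \<bullet> p' + w' \<bullet> w'" and le: "p \<bullet> p \<le> p' \<bullet> p'"
  shows "measure lebesgue (rtri p' w' \<inter> cball 0 r) * measure lebesgue (rtri p w)
    \<le> measure lebesgue (rtri p w \<inter> cball 0 r) * measure lebesgue (rtri p' w')"
proof -
  define f where "f = (\<lambda>x. (x \<bullet> p / (p \<bullet> p)) *\<^sub>R p' + (x \<bullet> w / (w \<bullet> w)) *\<^sub>R w')"
  define g where "g = (\<lambda>x. (x \<bullet> p' / (p' \<bullet> p')) *\<^sub>R p + (x \<bullet> w' / (w' \<bullet> w')) *\<^sub>R w)"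
  have linf: "linear f"
    by (rule linearI) (simp_all add: f_def inner_add_left add_divide_distrib algebra_simps)
  have fp: "f x \<bullet> p' / (p' \<bullet> p') = x \<bullet> p / (p \<bullet> p)"
    and fw: "f x \<bullet> w' / (w' \<bullet> w') = x \<bullet> w / (w \<bullet> w)" for x
    using o' inner_commute[of w' p'] by (simp_all add: f_def inner_add_left)
  have gp: "g x \<bullet> p / (p \<bullet> p) = x \<bullet> p' / (p' \<bullet> p')"
    and gw: "g x \<bullet> w / (w \<bullet> w) = x \<bullet> w' / (w' \<bullet> w')" for x
    using o inner_commute[of w p] by (simp_all add: g_def inner_add_left)
  have fg: "f (g y) = y" for y
    unfolding f_def gp gw using orthogonal_expansion_plane[OF o'] by metis
  have mem: "f x \<in> rtri p' w' \<longleftrightarrow> x \<in> rtri p w" for x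
    by (simp add: rtri_def fp fw)
  have im: "f ` rtri p w = rtri p' w'"
  proof (intro subset_antisym subsetI)
    show "y \<in> f ` rtri p w" if "y \<in> rtri p' w'" for y
      using that mem[of "g y"] fg[of y] by (metis rev_image_eqI)
  qed (auto simp: mem)
  have nrm: "norm x \<le> norm (f x)" if x: "x \<in> rtri p w" for x
  proof -
    define s t where "s = x \<bullet> p / (p \<bullet> p)" and "t = x \<bullet> w / (w \<bullet> w)"
    have st: "0 < t" "t < s" using x by (auto simp: rtri_def s_def t_def)
    have xx: "x \<bullet> x = s\<^sup>2 * (p \<bullet> p) + t\<^sup>2 * (w \<bullet> w)"
      unfolding s_def t_def by (rule inner_self_orthogonal_plane[OF o])
    have yy: "f x \<bullet> f x = s\<^sup>2 * (p' \<bullet> p') + t\<^sup>2 * (w' \<bullet> w')"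
      using inner_self_orthogonal_plane[OF o', of "f x"] unfolding fp fw s_def t_def .
    \<comment> \<open>With equal hypotenuses \<open>w\<close> loses in squared length exactly what
      \<open>p\<close> gains; the gain is weighted by \<open>s\<^sup>2\<close>, the loss by the
      smaller \<open>t\<^sup>2\<close>.\<close>
    have "f x \<bullet> f x - x \<bullet> x = (s\<^sup>2 - t\<^sup>2) * (p' \<bullet> p' - p \<bullet> p)"
      unfolding xx yy using hyp by algebra
    also have "\<dots> \<ge> 0" using st le by (intro mult_nonneg_nonneg) (auto simp: power_mono)
    finally show ?thesis by (simp add: norm_eq_sqrt_inner)
  qed
  \<comment> \<open>An image point in the disk has its preimage in the disk, since \<open>f\<close>
    does not decrease norms on the triangle.\<close>
  have sub: "rtri p' w' \<inter> cball 0 r \<subseteq> f ` (rtri p w \<inter> cball 0 r)"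
    using nrm unfolding im[symmetric] by force
  have "measure lebesgue (rtri p' w' \<inter> cball 0 r) \<le> measure lebesgue (f ` (rtri p w \<inter> cball 0 r))"
    using sub lmeasurable_rtri_Int[OF o] linf fmeasurableD[OF lmeasurable_rtri_Int[OF o']]
    by (intro measure_mono_fmeasurable) (auto intro: measurable_linear_image)
  also have "\<dots> = \<bar>det (matrix f)\<bar> * measure lebesgue (rtri p w \<inter> cball 0 r)"
    by (rule measure_linear_image[OF linf lmeasurable_rtri_Int[OF o]])
  finally have 1: "measure lebesgue (rtri p' w' \<inter> cball 0 r) \<le> \<dots>" .
  \<comment> \<open>The same determinant scales both areas, so it cancels from the ratio of
    densities.\<close>
  have 2: "measure lebesgue (rtri p' w') = \<bar>det (matrix f)\<bar> * measure lebesgue (rtri p w)"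
    unfolding im[symmetric] by (rule measure_linear_image[OF linf lmeasurable_rtri[OF o]])
  show ?thesis unfolding 2
    using mult_right_mono[OF 1, of "measure lebesgue (rtri p w)"] by (simp add: mult_ac)
qed

lemma measure_scaleR_plane:
  fixes S :: "(real^2) set"
  shows "measure lebesgue ((\<lambda>x. k *\<^sub>R x) ` S) = k\<^sup>2 * measure lebesgue S"
  using emeasure_lebesgue_affine[of k 0 S]
  by (simp add: measure_def enn2real_mult)

text \<open>Shrinking the triangle towards its vertex \<open>0\<close> by the factor
  \<open>k\<close> keeps it inside itself and moves it into the disk whose radius is
  \<open>k\<close> times the hypotenuse.\<close>

lemma rtri_Int_cball_ge:
  assumes o: "p \<bullet> w = 0" "p \<noteq> 0" "w \<noteq> 0"
    and k: "0 < k" "k \<le> 1"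
  shows "k\<^sup>2 * measure lebesgue (rtri p w)
    \<le> measure lebesgue (rtri p w \<inter> cball 0 (k * sqrt (p \<bullet> p + w \<bullet> w)))"
proof -
  have "(\<lambda>x. k *\<^sub>R x) ` rtri p w \<subseteq> rtri p w \<inter> cball 0 (k * sqrt (p \<bullet> p + w \<bullet> w))"
  proof (rule image_subsetI)
    fix x assume x: "x \<in> rtri p w"
    have "k * (x \<bullet> p / (p \<bullet> p)) < 1"
      using x k mult_mono[of k 1 "x \<bullet> p / (p \<bullet> p)" "x \<bullet> p / (p \<bullet> p)"] by (auto simp: rtri_def)
    moreover have "k * (x \<bullet> w / (w \<bullet> w)) < k * (x \<bullet> p / (p \<bullet> p))"
      using x k by (intro mult_strict_left_mono) (auto simp: rtri_def)
    moreover have "0 < k * (x \<bullet> w / (w \<bullet> w))"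
      using x k by (intro mult_pos_pos) (auto simp: rtri_def)
    ultimately show "k *\<^sub>R x \<in> rtri p w \<inter> cball 0 (k * sqrt (p \<bullet> p + w \<bullet> w))"
      using norm_less_rtri[OF o x] k by (auto simp: rtri_def)
  qed
  moreover have "(\<lambda>x. k *\<^sub>R x) ` rtri p w \<in> sets lebesgue"
    using borel_open[OF open_scaling[OF _ open_rtri]] k by (intro sets_completionI_sets) auto
  ultimately have "measure lebesgue ((\<lambda>x. k *\<^sub>R x) ` rtri p w)
      \<le> measure lebesgue (rtri p w \<inter> cball 0 (k * sqrt (p \<bullet> p + w \<bullet> w)))"
    by (intro measure_mono_fmeasurable lmeasurable_rtri_Int o) auto
  then show ?thesis by (simp add: measure_scaleR_plane)
qed

text \<open>Up to three lines the set is the closed triangle \<open>?H\<close>, whose area is half a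
  determinant; Lagrange's identity turns the determinant into the product of the legs.\<close>

lemma measure_rtri:
  assumes o: "p \<bullet> w = 0" "p \<noteq> 0" "w \<noteq> 0"
  shows "measure lebesgue (rtri p w) = sqrt ((p \<bullet> p) * (w \<bullet> w)) / 2"
proof -
  let ?H = "convex hull {0, p, p + w}"
  have pp: "p \<bullet> p > 0" and ww: "w \<bullet> w > 0" using o by auto
  have H: "x \<in> ?H \<longleftrightarrow> 0 \<le> x \<bullet> w / (w \<bullet> w) \<and> x \<bullet> w / (w \<bullet> w) \<le> x \<bullet> p / (p \<bullet> p) \<and> x \<bullet> p / (p \<bullet> p) \<le> 1" for x
  proof
    assume "x \<in> ?H"
    then obtain u v where uv: "0 \<le> u" "0 \<le> v" "u + v \<le> 1" "x = u *\<^sub>R p + v *\<^sub>R (p + w)"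
      by (auto simp: convex_hull_3_alt)
    have "x \<bullet> w / (w \<bullet> w) = v" "x \<bullet> p / (p \<bullet> p) = u + v"
      using o inner_commute[of w p] unfolding uv by (simp_all add: inner_add_left add_divide_distrib)
    then show "0 \<le> x \<bullet> w / (w \<bullet> w) \<and> x \<bullet> w / (w \<bullet> w) \<le> x \<bullet> p / (p \<bullet> p) \<and> x \<bullet> p / (p \<bullet> p) \<le> 1"
      using uv by auto
  next
    assume a: "0 \<le> x \<bullet> w / (w \<bullet> w) \<and> x \<bullet> w / (w \<bullet> w) \<le> x \<bullet> p / (p \<bullet> p) \<and> x \<bullet> p / (p \<bullet> p) \<le> 1"
    define s t where "s = x \<bullet> p / (p \<bullet> p)" and "t = x \<bullet> w / (w \<bullet> w)"
    have "x = s *\<^sub>R p + t *\<^sub>R w"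
      unfolding s_def t_def by (rule orthogonal_expansion_plane[OF o])
    then have "x = 0 + (s - t) *\<^sub>R (p - 0) + t *\<^sub>R (p + w - 0)" by (simp add: algebra_simps)
    moreover have "0 \<le> s - t" "0 \<le> t" "(s - t) + t \<le> 1" using a by (auto simp: s_def t_def)
    ultimately show "x \<in> ?H" unfolding convex_hull_3_alt by blast
  qed
  have "(p \<bullet> p) *\<^sub>R w \<noteq> (w \<bullet> w) *\<^sub>R p"
  proof
    assume "(p \<bullet> p) *\<^sub>R w = (w \<bullet> w) *\<^sub>R p"
    then have "((p \<bullet> p) *\<^sub>R w) \<bullet> p = ((w \<bullet> w) *\<^sub>R p) \<bullet> p" by simp
    then show False using o by (simp add: inner_commute)
  qed
  \<comment> \<open>These lines carry the leg \<open>p\<close>, the hypotenuse and the leg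
    \<open>w\<close>. The inequality just proved makes the normal vector of the hypotenuse
    nonzero.\<close>
  then have N: "negligible ({x. w \<bullet> x = 0} \<union> {x. ((p \<bullet> p) *\<^sub>R w - (w \<bullet> w) *\<^sub>R p) \<bullet> x = 0}
      \<union> {x. p \<bullet> x = p \<bullet> p})"
    using o by (intro negligible_Un negligible_hyperplane) auto
  have "measure lebesgue (rtri p w) = measure lebesgue ?H"
  proof (rule measure_negligible_symdiff)
    show "?H \<in> lmeasurable"
      by (intro lmeasurable_compact compact_convex_hull) simp
    have "?H - rtri p w \<union> (rtri p w - ?H) \<subseteq> {x. w \<bullet> x = 0}
      \<union> {x. ((p \<bullet> p) *\<^sub>R w - (w \<bullet> w) *\<^sub>R p) \<bullet> x = 0} \<union> {x. p \<bullet> x = p \<bullet> p}"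
    proof
      fix x assume "x \<in> ?H - rtri p w \<union> (rtri p w - ?H)"
      then consider "x \<bullet> w / (w \<bullet> w) = 0" | "x \<bullet> w / (w \<bullet> w) = x \<bullet> p / (p \<bullet> p)" | "x \<bullet> p / (p \<bullet> p) = 1"
        unfolding Un_iff Diff_iff H rtri_def mem_Collect_eq by linarith
      then show "x \<in> {x. w \<bullet> x = 0} \<union> {x. ((p \<bullet> p) *\<^sub>R w - (w \<bullet> w) *\<^sub>R p) \<bullet> x = 0}
        \<union> {x. p \<bullet> x = p \<bullet> p}"
      proof cases
        case 2
        then have "(x \<bullet> w) * (p \<bullet> p) = (x \<bullet> p) * (w \<bullet> w)"
          using pp ww by (simp only: frac_eq_eq less_imp_neq[symmetric] not_False_eq_True)
        moreover have "((p \<bullet> p) *\<^sub>R w - (w \<bullet> w) *\<^sub>R p) \<bullet> x = (x \<bullet> w) * (p \<bullet> p) - (x \<bullet> p) * (w \<bullet> w)"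
          by (simp add: inner_diff_left inner_diff_right inner_commute)
        ultimately have "((p \<bullet> p) *\<^sub>R w - (w \<bullet> w) *\<^sub>R p) \<bullet> x = 0" by simp
        then show ?thesis by blast
      qed (use pp ww in \<open>auto simp: inner_commute\<close>)
    qed
    then show "negligible (?H - rtri p w \<union> (rtri p w - ?H))"
      by (rule negligible_subset[OF N])
  qed
  also have "\<dots> = \<bar>p$1 * w$2 - p$2 * w$1\<bar> / 2"
  proof -
    have "?H \<in> sets borel" by (intro borel_closed compact_imp_closed compact_convex_hull) simp
    then have "measure lebesgue ?H = measure lborel ?H" by simp
    then show ?thesis unfolding content_triangle by (simp add: algebra_simps abs_minus_commute)
  qed
  also have "\<bar>p$1 * w$2 - p$2 * w$1\<bar> = sqrt ((p$1 * w$2 - p$2 * w$1)\<^sup>2)" by simp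
  also have "(p$1 * w$2 - p$2 * w$1)\<^sup>2 = (p \<bullet> p) * (w \<bullet> w) - (p \<bullet> w)\<^sup>2"
    by (simp add: inner_vec_def sum_2) algebra
  finally show ?thesis using o by simp
qed

section \<open>The regular triangle\<close>

lemma regular_triangle2_inner:
  assumes "regular_triangle2 a b c"
  shows "(b - a) \<bullet> (b - a) = 4" "(c - a) \<bullet> (c - a) = 4" "(b - a) \<bullet> (c - a) = 2"
proof -
  have d: "dist a b = 2" "dist b c = 2" "dist c a = 2"
    using assms by (auto simp: regular_triangle2_def)
  show b: "(b - a) \<bullet> (b - a) = 4" and c: "(c - a) \<bullet> (c - a) = 4"
    using d by (simp_all add: dist_norm norm_minus_commute flip: power2_norm_eq_inner)
  have "(b - c) \<bullet> (b - c) = 4"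
    using d by (simp add: dist_norm flip: power2_norm_eq_inner)
  moreover have "(b - c) \<bullet> (b - c) = (b - a) \<bullet> (b - a) + (c - a) \<bullet> (c - a) - 2 * ((b - a) \<bullet> (c - a))"
    by (simp add: inner_diff_left inner_diff_right inner_commute)
  ultimately show "(b - a) \<bullet> (c - a) = 2" using b c by simp
qed

text \<open>The medians cut a regular triangle into six right triangles, one for each ordering of the
  vertices: the points whose distances to the vertices are in that order. Their hypotenuses are the
  circumradius \<open>2 / sqrt 3\<close>.\<close>

definition flag_triangle :: "real^2 \<Rightarrow> real^2 \<Rightarrow> real^2 \<Rightarrow> (real^2) set" where
  "flag_triangle a b c = (+) a ` rtri ((1/2) *\<^sub>R (b - a)) ((1/6) *\<^sub>R (2 *\<^sub>R (c - a) - (b - a)))"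

text \<open>The vector \<open>p\<close> leads from \<open>a\<close> to the midpoint of the side to
  \<open>b\<close>, and \<open>w\<close> leads from there to the centroid, so \<open>w\<close> is as
  long as the inradius.\<close>

lemma flag_triangle_legs:
  assumes "regular_triangle2 a b c"
  defines "p \<equiv> (1/2) *\<^sub>R (b - a)" and "w \<equiv> (1/6) *\<^sub>R (2 *\<^sub>R (c - a) - (b - a))"
  shows "p \<bullet> p = 1" "w \<bullet> w = 1/3" "p \<bullet> w = 0" "p \<noteq> 0" "w \<noteq> 0"
proof -
  define u v where "u = b - a" and "v = c - a"
  have uv: "u \<bullet> u = 4" "v \<bullet> v = 4" "u \<bullet> v = 2" "v \<bullet> u = 2"
    using regular_triangle2_inner[OF assms(1)] by (simp_all add: u_def v_def inner_commute)
  have pw: "p = (1/2) *\<^sub>R u" "w = (1/6) *\<^sub>R (2 *\<^sub>R v - u)" by (simp_all add: p_def w_def u_def v_def)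
  show "p \<bullet> p = 1" "w \<bullet> w = 1/3" "p \<bullet> w = 0"
    unfolding pw using uv by (simp_all add: inner_diff_left inner_diff_right)
  then show "p \<noteq> 0" "w \<noteq> 0" by auto
qed

text \<open>The order of the distances makes the six triangles disjoint; membership in the hull
  places them all in the regular triangle.\<close>

lemma flag_triangleD:
  assumes reg: "regular_triangle2 a b c" and x: "x \<in> flag_triangle a b c"
  shows "dist x a < dist x b" "dist x b < dist x c" "x \<in> convex hull {a, b, c}"
proof -
  define u v where "u = b - a" and "v = c - a"
  have uv: "u \<bullet> u = 4" "v \<bullet> v = 4" "u \<bullet> v = 2" "v \<bullet> u = 2"
    using regular_triangle2_inner[OF reg] by (simp_all add: u_def v_def inner_commute)
  define p w where "p = (1/2) *\<^sub>R u" and "w = (1/6) *\<^sub>R (2 *\<^sub>R v - u)"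
  note pw = flag_triangle_legs[OF reg, folded u_def v_def, folded p_def w_def]
  define y where "y = x - a"
  have y: "y \<in> rtri p w"
    using x by (auto simp: flag_triangle_def p_def w_def u_def v_def y_def)
  define s t where "s = y \<bullet> p" and "t = 3 * (y \<bullet> w)"
  have st: "0 < t" "t < s" "s < 1" using y pw by (auto simp: rtri_def s_def t_def)
  have eqs: "2 * s = y \<bullet> u" "2 * t = 2 * (y \<bullet> v) - y \<bullet> u"
    by (simp_all add: s_def t_def p_def w_def inner_diff_right)
  have "x = a + y" "x - b = y - u" "x - c = y - v" by (simp_all add: y_def u_def v_def)
  then have d: "dist x a = norm y" "dist x b = norm (y - u)" "dist x c = norm (y - v)"
    by (simp add: dist_norm y_def, simp_all only: dist_norm)
  \<comment> \<open>Here \<open>s < 1\<close> is the side of \<open>a\<close> at the bisector of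
    \<open>a\<close> and \<open>b\<close>, and \<open>t < s\<close> is the side of \<open>b\<close>
    at the bisector of \<open>b\<close> and \<open>c\<close>.\<close>
  have "y \<bullet> y < (y - u) \<bullet> (y - u)" "(y - u) \<bullet> (y - u) < (y - v) \<bullet> (y - v)"
    using st eqs uv by (simp_all add: inner_diff_left inner_diff_right inner_commute)
  then show "dist x a < dist x b" "dist x b < dist x c"
    unfolding d norm_eq_sqrt_inner by simp_all
  have "y = s *\<^sub>R p + t *\<^sub>R w"
    using orthogonal_expansion_plane[OF pw(3-5), of y] pw(1,2) by (simp add: s_def t_def mult.commute)
  then have "y = (s/2 - t/6) *\<^sub>R u + (t/3) *\<^sub>R v"
    by (simp add: p_def w_def algebra_simps)
  then have "x = a + (s/2 - t/6) *\<^sub>R (b - a) + (t/3) *\<^sub>R (c - a)"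
    using \<open>x = a + y\<close> unfolding u_def v_def by simp
  moreover have "0 \<le> s/2 - t/6" "0 \<le> t/3" "(s/2 - t/6) + t/3 \<le> 1" using st by auto
  ultimately show "x \<in> convex hull {a, b, c}" unfolding convex_hull_3_alt by blast
qed

lemma lmeasurable_flag_triangle_Int:
  assumes "regular_triangle2 a b c"
  shows "flag_triangle a b c \<inter> cball a r \<in> lmeasurable"
  unfolding flag_triangle_def
  by (intro fmeasurable.Int measurable_translation lmeasurable_rtri flag_triangle_legs[OF assms]) simp

text \<open>The flag triangle has the same hypotenuse and leg 1, the smallest leg allowed by
  \<open>le\<close>, so \<open>rtri_density_antimono\<close> applies; \<open>sqrt 3 / 6\<close> is
  its area.\<close>

lemma flag_triangle_density:
  assumes reg: "regular_triangle2 a b c"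
    and o: "p \<bullet> w = 0" "p \<noteq> 0" "w \<noteq> 0" and hyp: "p \<bullet> p + w \<bullet> w = 4/3" and le: "1 \<le> p \<bullet> p"
  shows "measure lebesgue (rtri p w \<inter> cball 0 r) * (sqrt 3 / 6)
    \<le> measure lebesgue (flag_triangle a b c \<inter> cball a r) * measure lebesgue (rtri p w)"
proof -
  let ?p = "(1/2) *\<^sub>R (b - a)" and ?w = "(1/6) *\<^sub>R (2 *\<^sub>R (c - a) - (b - a))"
  note pw = flag_triangle_legs[OF reg]
  have "flag_triangle a b c \<inter> cball a r = (+) a ` (rtri ?p ?w \<inter> cball 0 r)"
    by (auto simp: flag_triangle_def dist_norm)
  then have E: "measure lebesgue (flag_triangle a b c \<inter> cball a r) = measure lebesgue (rtri ?p ?w \<inter> cball 0 r)"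
    by (simp add: measure_translation)
  have E': "measure lebesgue (rtri ?p ?w) = sqrt 3 / 6"
    unfolding measure_rtri[OF pw(3-5)] pw(1,2) by (simp add: real_sqrt_divide divide_simps)
  show ?thesis
    using rtri_density_antimono[OF pw(3-5) o, of r] hyp le unfolding pw(1,2) E E' by simp
qed

lemma measure_regular_triangle2:
  assumes "regular_triangle2 a b c"
  shows "measure lebesgue (convex hull {a, b, c}) = sqrt 3"
proof -
  let ?d = "(c$1 - a$1) * (b$2 - a$2) - (b$1 - a$1) * (c$2 - a$2)"
  have "convex hull {a, b, c} \<in> sets borel"
    by (intro borel_closed compact_imp_closed compact_convex_hull) simp
  then have "measure lebesgue (convex hull {a, b, c}) = \<bar>?d\<bar> / 2" by (simp add: content_triangle)
  also have "\<bar>?d\<bar> = sqrt (?d\<^sup>2)" by simp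
  also have "?d\<^sup>2 = ((b - a) \<bullet> (b - a)) * ((c - a) \<bullet> (c - a)) - ((b - a) \<bullet> (c - a))\<^sup>2"
    by (simp add: inner_vec_def sum_2) algebra
  also have "\<dots> = 2\<^sup>2 * 3" using regular_triangle2_inner[OF assms] by simp
  also have "sqrt \<dots> / 2 = sqrt 3" unfolding real_sqrt_mult real_sqrt_abs by simp
  finally show ?thesis .
qed

text \<open>Adding \<open>flag_triangle_density\<close> over the six orders of the vertices produces
  \<open>6 * (sqrt 3 / 6)\<close>, the area of the regular triangle, on one side. On the other side
  are disjoint pieces of the region measured in \<open>sigma_bar\<close>, each cut out by the disk
  about its nearest vertex.\<close>

lemma rtri_density_le_sigma_bar:
  assumes reg: "regular_triangle2 t1 t2 t3"
    and o: "p \<bullet> w = 0" "p \<noteq> 0" "w \<noteq> 0" and hyp: "p \<bullet> p + w \<bullet> w = 4/3" and le: "1 \<le> p \<bullet> p"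
  shows "measure lebesgue (rtri p w \<inter> cball 0 (1 + l))
    \<le> sigma_bar t1 t2 t3 l * measure lebesgue (rtri p w)"
proof -
  let ?T = "convex hull {t1, t2, t3}"
  define I where "I = {(t1,t2,t3), (t1,t3,t2), (t2,t1,t3), (t2,t3,t1), (t3,t1,t2), (t3,t2,t1)}"
  define F where "F = (\<lambda>(a,b,c). flag_triangle a b c \<inter> cball a (1 + l))"
  have ne: "t1 \<noteq> t2" "t2 \<noteq> t3" "t3 \<noteq> t1" using reg by (auto simp: regular_triangle2_def)
  have regI: "regular_triangle2 a b c" "{a, b, c} = {t1, t2, t3}" if "(a, b, c) \<in> I" for a b c
    using that reg by (auto simp: I_def regular_triangle2_def dist_commute)
  have card: "card I = 6" "finite I" using ne by (auto simp: I_def)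
  have "6 * (measure lebesgue (rtri p w \<inter> cball 0 (1 + l)) * (sqrt 3 / 6))
      = (\<Sum>i\<in>I. measure lebesgue (rtri p w \<inter> cball 0 (1 + l)) * (sqrt 3 / 6))"
    using card by simp
  also have "\<dots> \<le> (\<Sum>i\<in>I. measure lebesgue (F i) * measure lebesgue (rtri p w))"
    using flag_triangle_density[OF regI(1) o hyp le]
    by (intro sum_mono) (auto simp: F_def split: prod.splits)
  also have "\<dots> = measure lebesgue (\<Union>i\<in>I. F i) * measure lebesgue (rtri p w)"
  proof -
    have "F i \<in> lmeasurable" if "i \<in> I" for i
      using that lmeasurable_flag_triangle_Int[OF regI(1)] by (auto simp: F_def split: prod.splits)
    moreover have "pairwise (\<lambda>i j. disjnt (F i) (F j)) I"
    proof -
      have "i = j" if "i \<in> I" "j \<in> I" "x \<in> F i" "x \<in> F j" for i j x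
      proof -
        obtain a b c a' b' c' where ij: "i = (a, b, c)" "j = (a', b', c')"
          by (metis prod_cases3)
        \<comment> \<open>The distances from \<open>x\<close> to the vertices determine their order,
          hence the index.\<close>
        have "dist x a < dist x b" "dist x b < dist x c" "dist x a' < dist x b'" "dist x b' < dist x c'"
          using that flag_triangleD(1,2)[OF regI(1)] unfolding ij F_def by auto
        then show ?thesis using that(1,2) unfolding ij I_def by auto
      qed
      then show ?thesis by (auto simp: pairwise_def disjnt_def)
    qed
    ultimately have "measure lebesgue (\<Union>i\<in>I. F i) = (\<Sum>i\<in>I. measure lebesgue (F i))"
      using card by (intro measure_UNION') auto
    then show ?thesis by (simp add: sum_distrib_right)
  qed
  also have "\<dots> \<le> measure lebesgue (?T \<inter> (\<Union>t\<in>{t1, t2, t3}. cball t (1 + l))) * measure lebesgue (rtri p w)"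
  proof (intro mult_right_mono measure_mono_fmeasurable)
    show "(\<Union>i\<in>I. F i) \<subseteq> ?T \<inter> (\<Union>t\<in>{t1, t2, t3}. cball t (1 + l))"
    proof (clarify, intro IntI)
      fix x a b c assume i: "(a, b, c) \<in> I" and x: "x \<in> F (a, b, c)"
      show "x \<in> ?T" using flag_triangleD(3)[OF regI(1)[OF i]] x regI(2)[OF i] by (auto simp: F_def)
      show "x \<in> (\<Union>t\<in>{t1, t2, t3}. cball t (1 + l))"
        unfolding regI(2)[OF i, symmetric] using x by (auto simp: F_def)
    qed
    show "(\<Union>i\<in>I. F i) \<in> sets lebesgue"
      using card lmeasurable_flag_triangle_Int[OF regI(1)]
      by (intro sets.finite_UN) (auto simp: F_def split: prod.splits)
    show "?T \<inter> (\<Union>t\<in>{t1, t2, t3}. cball t (1 + l)) \<in> lmeasurable"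
      by (intro fmeasurable.Int fmeasurable.finite_UN lmeasurable_compact compact_convex_hull) auto
  qed simp
  finally show ?thesis
    unfolding sigma_bar_def measure_regular_triangle2[OF reg] by (simp add: field_simps)
qed

section \<open>Voronoi cells\<close>

text \<open>The squared sides sum to at most three times the sum of the squared distances to
  \<open>x\<close>, hence to less than 12. The two nonstrict bounds admit a point at distance
  exactly \<open>2 / sqrt 3\<close>, as the origin is in \<open>cap_cone_disjoint\<close>.\<close>

lemma no_three_in_small_disk:
  fixes a b c x :: "'a::real_inner"
  assumes "2 \<le> dist a b" "2 \<le> dist b c" "2 \<le> dist c a"
    and "(dist x a)\<^sup>2 \<le> 4/3" "(dist x b)\<^sup>2 \<le> 4/3" "(dist x c)\<^sup>2 < 4/3"
  shows False
proof -
  define u v w where "u = a - x" and "v = b - x" and "w = c - x"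
  have "4 \<le> (dist a b)\<^sup>2" "4 \<le> (dist b c)\<^sup>2" "4 \<le> (dist c a)\<^sup>2"
    using assms(1-3)[THEN power_mono, of 2] by simp_all
  then have "4 \<le> (u - v) \<bullet> (u - v)" "4 \<le> (v - w) \<bullet> (v - w)" "4 \<le> (w - u) \<bullet> (w - u)"
    by (simp_all add: dist_norm power2_norm_eq_inner u_def v_def w_def)
  moreover have "(u - v) \<bullet> (u - v) + (v - w) \<bullet> (v - w) + (w - u) \<bullet> (w - u)
      = 3 * (u \<bullet> u) + 3 * (v \<bullet> v) + 3 * (w \<bullet> w) - (u + v + w) \<bullet> (u + v + w)"
    by (simp add: inner_diff_left inner_diff_right inner_add_left inner_add_right inner_commute)
  moreover have "3 * (u \<bullet> u) \<le> 4" "3 * (v \<bullet> v) \<le> 4" "3 * (w \<bullet> w) < 4"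
    using assms(4-6) by (simp_all add: dist_norm power2_norm_eq_inner norm_minus_commute u_def v_def w_def)
  moreover have "0 \<le> (u + v + w) \<bullet> (u + v + w)" by (rule inner_ge_zero)
  ultimately show False by linarith
qed

text \<open>The open Voronoi cell of a center moved to the origin; \<open>D\<close> holds the other
  centers as seen from it.\<close>

definition origin_cell :: "(real^2) set \<Rightarrow> (real^2) set" where
  "origin_cell D = {x. \<forall>d\<in>D. norm x < dist x d}"

lemma dist_greater_norm_iff:
  fixes x d :: "'a::real_inner"
  shows "norm x < dist x d \<longleftrightarrow> x \<bullet> d < (d \<bullet> d) / 2"
proof -
  have "norm x < dist x d \<longleftrightarrow> x \<bullet> x < (x - d) \<bullet> (x - d)"
    by (simp add: dist_norm norm_eq_sqrt_inner)
  also have "\<dots> \<longleftrightarrow> x \<bullet> d < (d \<bullet> d) / 2"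
    by (auto simp: inner_diff_left inner_diff_right inner_commute)
  finally show ?thesis .
qed

text \<open>The cone over the cap that the bisector of \<open>0\<close> and \<open>2 *\<^sub>R p\<close> cuts off from \<open>ball 0 \<rho>\<close>.\<close>

definition cap_cone :: "real \<Rightarrow> real^2 \<Rightarrow> (real^2) set" where
  "cap_cone \<rho> p = {x. (p \<bullet> p) * norm x < \<rho> * (x \<bullet> p)}"

lemma open_cap_cone: "open (cap_cone \<rho> p)"
  unfolding cap_cone_def by (intro open_Collect_less continuous_intros)

text \<open>The bisector meets the circle of radius \<open>\<rho>\<close> in \<open>p + w\<close>
  and \<open>p - w\<close>, so the cone is the open sector between the rays through these two
  points.\<close>

lemma cap_cone_eq_triangle:
  assumes o: "p \<bullet> w = 0" "p \<noteq> 0" "w \<noteq> 0" and hyp: "p \<bullet> p + w \<bullet> w = \<rho>\<^sup>2" and "0 < \<rho>"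
  shows "x \<in> cap_cone \<rho> p \<longleftrightarrow> \<bar>x \<bullet> w / (w \<bullet> w)\<bar> < x \<bullet> p / (p \<bullet> p)"
proof -
  define s t where "s = x \<bullet> p / (p \<bullet> p)" and "t = x \<bullet> w / (w \<bullet> w)"
  have pp: "p \<bullet> p > 0" and ww: "w \<bullet> w > 0" using o by auto
  have xx: "x \<bullet> x = s\<^sup>2 * (p \<bullet> p) + t\<^sup>2 * (w \<bullet> w)"
    unfolding s_def t_def by (rule inner_self_orthogonal_plane[OF o])
  have "x \<in> cap_cone \<rho> p \<longleftrightarrow> norm x < \<rho> * s"
    using pp by (simp add: cap_cone_def s_def field_simps)
  also have "\<dots> \<longleftrightarrow> 0 < s \<and> norm x < \<rho> * s"
    using \<open>0 < \<rho>\<close> by (metis norm_ge_zero order_le_less_trans zero_less_mult_pos)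
  also have "\<dots> \<longleftrightarrow> 0 < s \<and> (norm x)\<^sup>2 < (\<rho> * s)\<^sup>2"
    using \<open>0 < \<rho>\<close> by (auto intro: power_strict_mono power_less_imp_less_base)
  also have "(norm x)\<^sup>2 < (\<rho> * s)\<^sup>2 \<longleftrightarrow> 0 < (s\<^sup>2 - t\<^sup>2) * (w \<bullet> w)"
    unfolding power2_norm_eq_inner xx power_mult_distrib hyp[symmetric] by (simp add: algebra_simps)
  also have "\<dots> \<longleftrightarrow> \<bar>t\<bar>\<^sup>2 < s\<^sup>2" using ww by (auto simp: zero_less_mult_iff simp del: inner_gt_zero_iff)
  also have "0 < s \<and> \<bar>t\<bar>\<^sup>2 < s\<^sup>2 \<longleftrightarrow> \<bar>t\<bar> < s"
    by (meson abs_ge_zero less_imp_le order_le_less_trans power_less_imp_less_base power_strict_mono zero_less_numeral)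
  finally show ?thesis unfolding s_def t_def .
qed

text \<open>A common point, moved radially to the circle of radius \<open>\<rho>\<close>, would have
  distance \<open>\<rho>\<close> from \<open>0\<close> and less than \<open>\<rho>\<close> from
  \<open>d\<close> and \<open>e\<close>, against \<open>no_three_in_small_disk\<close>.\<close>

lemma cap_cone_disjoint:
  assumes "2 \<le> norm d" "2 \<le> norm e" "2 \<le> dist d e" and \<rho>: "\<rho>\<^sup>2 = 4/3" "0 < \<rho>"
  shows "cap_cone \<rho> ((1/2) *\<^sub>R d) \<inter> cap_cone \<rho> ((1/2) *\<^sub>R e) = {}"
proof (rule ccontr)
  assume "\<not> ?thesis"
  then obtain x where x: "x \<in> cap_cone \<rho> ((1/2) *\<^sub>R d)" "x \<in> cap_cone \<rho> ((1/2) *\<^sub>R e)" by blast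
  have "x \<noteq> 0" using x by (auto simp: cap_cone_def)
  define y where "y = (\<rho> / norm x) *\<^sub>R x"
  have ny: "norm y = \<rho>" using \<open>x \<noteq> 0\<close> \<open>0 < \<rho>\<close> by (simp add: y_def)
  have "dist y a < \<rho>" if "x \<in> cap_cone \<rho> ((1/2) *\<^sub>R a)" for a
  proof -
    have "(a \<bullet> a) * norm x < 2 * \<rho> * (x \<bullet> a)" using that by (simp add: cap_cone_def mult_ac)
    then have "(a \<bullet> a) < 2 * (y \<bullet> a)"
      using \<open>x \<noteq> 0\<close> by (simp add: y_def field_simps)
    then have "(y - a) \<bullet> (y - a) < y \<bullet> y"
      by (simp add: inner_diff_left inner_diff_right inner_commute)
    then have "dist y a < norm y" by (simp add: dist_norm norm_eq_sqrt_inner)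
    then show ?thesis using ny by simp
  qed
  note less = this[OF x(1)] this[OF x(2)]
  have "(dist y d)\<^sup>2 < \<rho>\<^sup>2" "(dist y e)\<^sup>2 < \<rho>\<^sup>2"
    using less by (intro power_strict_mono; simp)+
  moreover have "(dist y 0)\<^sup>2 = \<rho>\<^sup>2" using ny by simp
  ultimately show False
    using no_three_in_small_disk[of 0 d e y] assms by (simp add: dist_commute)
qed

lemma exists_orthogonal_plane:
  fixes p :: "real^2"
  assumes "p \<noteq> 0" "0 < k"
  obtains w where "p \<bullet> w = 0" "w \<bullet> w = k"
proof -
  define q :: "real^2" where "q = vector [- p$2, p$1]"
  have q: "p \<bullet> q = 0" "q \<bullet> q = p \<bullet> p"
    by (simp_all add: q_def inner_vec_def sum_2)
  show ?thesis
    by (rule that[of "sqrt (k / (p \<bullet> p)) *\<^sub>R q"]) (use q assms in \<open>simp_all add: real_sqrt_mult_self flip: mult.assoc\<close>)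
qed

text \<open>Inside a cap cone the cell is an isosceles triangle, that is, two right triangles.\<close>

lemma cap_cone_density:
  assumes reg: "regular_triangle2 t1 t2 t3"
    and p: "1 \<le> p \<bullet> p" "p \<bullet> p < 4/3" and \<rho>: "\<rho>\<^sup>2 = 4/3" "0 < \<rho>"
  defines "S \<equiv> cap_cone \<rho> p \<inter> {x. x \<bullet> p < p \<bullet> p}"
  shows "S \<subseteq> ball 0 \<rho>"
    and "measure lebesgue (S \<inter> cball 0 (1 + l)) \<le> sigma_bar t1 t2 t3 l * measure lebesgue S"
proof -
  have "p \<noteq> 0" using p by auto
  \<comment> \<open>\<open>w\<close> is half the chord that the bisector cuts from the circle of
    radius \<open>\<rho>\<close>; this makes the hypotenuse \<open>\<rho>\<close>.\<close>
  obtain w where w: "p \<bullet> w = 0" "w \<bullet> w = 4/3 - p \<bullet> p"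
    using exists_orthogonal_plane[OF \<open>p \<noteq> 0\<close>, of "4/3 - p \<bullet> p"] p by auto
  have o: "p \<bullet> w = 0" "p \<noteq> 0" "w \<noteq> 0" and o': "p \<bullet> (- w) = 0" "p \<noteq> 0" "- w \<noteq> 0"
    using p w \<open>p \<noteq> 0\<close> by auto
  have hyp: "p \<bullet> p + w \<bullet> w = 4/3" and hyp': "p \<bullet> p + (- w) \<bullet> (- w) = 4/3" using w by auto
  show sub: "S \<subseteq> ball 0 \<rho>"
  proof
    fix x assume "x \<in> S"
    then have "(p \<bullet> p) * norm x < \<rho> * (x \<bullet> p)" "x \<bullet> p < p \<bullet> p" by (auto simp: S_def cap_cone_def)
    moreover from this have "\<rho> * (x \<bullet> p) < (p \<bullet> p) * \<rho>"
      using mult_strict_left_mono[of "x \<bullet> p" "p \<bullet> p" \<rho>] \<open>0 < \<rho>\<close> by (simp add: mult.commute)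
    ultimately have "(p \<bullet> p) * norm x < (p \<bullet> p) * \<rho>" by linarith
    then show "x \<in> ball 0 \<rho>" using p by (simp add: mult_less_cancel_left)
  qed
  have "open S" unfolding S_def
    by (intro open_Int open_cap_cone open_Collect_less continuous_intros)
  then have S: "S \<in> lmeasurable"
    using sub bounded_subset[OF bounded_ball] by (intro lmeasurable_open) auto
  have R: "rtri p w \<in> lmeasurable" "rtri p (- w) \<in> lmeasurable"
    using lmeasurable_rtri o o' by auto
  have Siff: "x \<in> S \<longleftrightarrow> \<bar>x \<bullet> w / (w \<bullet> w)\<bar> < x \<bullet> p / (p \<bullet> p) \<and> x \<bullet> p / (p \<bullet> p) < 1" for x
    using cap_cone_eq_triangle[OF o _ \<rho>(2), of x] hyp \<rho> p by (auto simp: S_def divide_less_eq_1)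
  have ww: "w \<bullet> w > 0" using o by simp
  have disj: "rtri p w \<inter> rtri p (- w) = {}"
    using ww by (auto simp: rtri_def divide_simps)
  have parts: "rtri p w \<subseteq> S" "rtri p (- w) \<subseteq> S"
    by (auto simp: Siff rtri_def)
  \<comment> \<open>The two mirror-image triangles miss only the axis of \<open>S\<close>, the line
    through \<open>0\<close> and \<open>p\<close>.\<close>
  have "x \<bullet> w / (w \<bullet> w) = 0" if "x \<in> S - (rtri p w \<union> rtri p (- w))" for x
    using that unfolding Siff rtri_def Diff_iff Un_iff mem_Collect_eq inner_minus_left inner_minus_right
      minus_minus minus_divide_left[symmetric] by linarith
  then have "S - (rtri p w \<union> rtri p (- w)) \<subseteq> {x. w \<bullet> x = 0}"
    using ww by (auto simp: inner_commute)
  then have N: "negligible (S - (rtri p w \<union> rtri p (- w)))"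
    by (rule negligible_subset[rotated]) (use o in \<open>auto intro: negligible_hyperplane\<close>)
  \<comment> \<open>Taking the disk for \<open>X\<close> splits the left side of the claim, taking
    \<open>UNIV\<close> the right side.\<close>
  have split: "measure lebesgue (S \<inter> X) = measure lebesgue (rtri p w \<inter> X) + measure lebesgue (rtri p (- w) \<inter> X)"
    if X: "X \<in> sets lebesgue" for X
  proof -
    have "measure lebesgue (S \<inter> X) = measure lebesgue ((rtri p w \<inter> X) \<union> (rtri p (- w) \<inter> X))"
      using R S X parts(1,2)
      by (intro measure_negligible_symdiff fmeasurable.Un fmeasurable_Int_fmeasurable negligible_subset[OF N]) auto
    also have "\<dots> = measure lebesgue (rtri p w \<inter> X) + measure lebesgue (rtri p (- w) \<inter> X)"
      using fmeasurable_Int_fmeasurable[OF R(1) X] fmeasurable_Int_fmeasurable[OF R(2) X] disj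
      by (intro measure_Un_disjoint) auto
    finally show ?thesis .
  qed
  show "measure lebesgue (S \<inter> cball 0 (1 + l)) \<le> sigma_bar t1 t2 t3 l * measure lebesgue S"
    using split[of "cball 0 (1 + l)"] split[of UNIV]
      rtri_density_le_sigma_bar[OF reg o hyp p(1), of l] rtri_density_le_sigma_bar[OF reg o' hyp' p(1), of l]
    by (simp add: algebra_simps)
qed

text \<open>The left side is the density of the disk in a conic region, so this bound serves the
  part of a cell outside the cones. Shrinking a right triangle with leg 1 shows that the disk has at
  least this density in it, and that density is at most \<sigma>.\<close>

lemma sigma_bar_ge:
  assumes reg: "regular_triangle2 t1 t2 t3" and l: "0 \<le> l" "(1 + l)\<^sup>2 \<le> 4/3"
  shows "(1 + l)\<^sup>2 / (4/3) \<le> sigma_bar t1 t2 t3 l"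
proof -
  obtain w :: "real^2" where w: "axis 1 1 \<bullet> w = 0" "w \<bullet> w = 1/3"
    using exists_orthogonal_plane[of "axis 1 1" "1/3"] by (auto simp: axis_eq_0_iff)
  let ?p = "axis 1 1 :: real^2"
  have o: "?p \<bullet> w = 0" "?p \<noteq> 0" "w \<noteq> 0" using w by (auto simp: axis_eq_0_iff)
  have hyp: "?p \<bullet> ?p + w \<bullet> w = 4/3" "1 \<le> ?p \<bullet> ?p" using w by (auto simp: inner_axis)
  define k where "k = (1 + l) / sqrt (4/3)"
  have k: "0 < k" "k\<^sup>2 = (1 + l)\<^sup>2 / (4/3)" using l by (auto simp: k_def power_divide)
  then have "k \<le> 1" using l by (intro power2_le_imp_le[of k 1]) auto
  have "k * sqrt (4/3) = 1 + l" by (simp add: k_def)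
  then have "k\<^sup>2 * measure lebesgue (rtri ?p w) \<le> sigma_bar t1 t2 t3 l * measure lebesgue (rtri ?p w)"
    using rtri_Int_cball_ge[OF o k(1) \<open>k \<le> 1\<close>] rtri_density_le_sigma_bar[OF reg o hyp, of l]
    unfolding hyp(1) by simp
  moreover have "measure lebesgue (rtri ?p w) > 0" using o by (simp add: measure_rtri)
  ultimately show ?thesis using k by simp
qed

section \<open>Density in the truncated Voronoi cell\<close>

lemma finite_separated_bounded:
  fixes D :: "'a::heine_borel set"
  assumes "0 < e" "\<And>x y. x \<in> D \<Longrightarrow> y \<in> D \<Longrightarrow> x \<noteq> y \<Longrightarrow> e \<le> dist x y" "bounded D"
  shows "finite D"
  using assms uniformI2[of e D] uniform_discrete_finite_iff by blast

lemma open_origin_cell: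
  assumes "finite D"
  shows "open (origin_cell D)"
proof -
  have "origin_cell D = (\<Inter>d\<in>D. {x. norm x < dist x d})" by (auto simp: origin_cell_def)
  also have "open \<dots>" using assms by (intro open_INT ballI open_Collect_less continuous_intros) auto
  finally show ?thesis .
qed

text \<open>By the triangle inequality a point of \<open>ball 0 \<rho>\<close> is nearer to
  \<open>0\<close> than to any center at distance \<open>2 * \<rho>\<close> or more, so such centers
  do not cut the truncated cell.\<close>

lemma origin_cell_Int_ball:
  "origin_cell D \<inter> ball 0 \<rho> = origin_cell (D \<inter> ball 0 (2 * \<rho>)) \<inter> ball 0 \<rho>"
proof -
  have far: "norm x < dist x d" if "norm x < \<rho>" "d \<notin> ball 0 (2 * \<rho>)" for x d :: "real^2"
    using that norm_triangle_ineq4[of x "x - d"] by (simp add: dist_norm)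
  have "x \<in> origin_cell D" if x: "x \<in> origin_cell (D \<inter> ball 0 (2 * \<rho>))" "x \<in> ball 0 \<rho>" for x
    unfolding origin_cell_def
  proof (intro CollectI ballI)
    fix d assume "d \<in> D"
    then show "norm x < dist x d"
      using x far[of x d] by (cases "d \<in> ball 0 (2 * \<rho>)") (auto simp: origin_cell_def)
  qed
  moreover have "origin_cell D \<subseteq> origin_cell (D \<inter> ball 0 (2 * \<rho>))" by (auto simp: origin_cell_def)
  ultimately show ?thesis by blast
qed

text \<open>The identity \<open>cell\<close> splits the cell within \<open>B\<close> into the part
  of \<open>B\<close> outside all cones, which lies wholly in the cell, and one triangle
  \<open>S d\<close> per neighbor. Applying it to both disks reduces the claim to these
  pieces.\<close>

lemma origin_cell_density_finite:
  assumes reg: "regular_triangle2 t1 t2 t3"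
    and l: "0 \<le> l" "1 + l < \<rho>" and \<rho>: "\<rho>\<^sup>2 = 4/3"
    and D: "finite D" "\<And>d. d \<in> D \<Longrightarrow> 2 \<le> norm d" "\<And>d. d \<in> D \<Longrightarrow> norm d < 2 * \<rho>"
      "\<And>d e. d \<in> D \<Longrightarrow> e \<in> D \<Longrightarrow> d \<noteq> e \<Longrightarrow> 2 \<le> dist d e"
  shows "measure lebesgue (origin_cell D \<inter> cball 0 (1 + l))
    \<le> sigma_bar t1 t2 t3 l * measure lebesgue (origin_cell D \<inter> ball 0 \<rho>)"
proof -
  let ?r = "1 + l" and ?\<sigma> = "sigma_bar t1 t2 t3 l"
  define p where "p = (\<lambda>d::real^2. (1/2) *\<^sub>R d)"
  define S where "S = (\<lambda>d. cap_cone \<rho> (p d) \<inter> {x. x \<bullet> p d < p d \<bullet> p d})"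
  define K where "K = (\<Union>d\<in>D. cap_cone \<rho> (p d))"
  have "0 < \<rho>" using l by simp
  have "?r\<^sup>2 \<le> 4/3" unfolding \<rho>[symmetric] using l by (intro power_mono) auto
  have p: "1 \<le> p d \<bullet> p d" "p d \<bullet> p d < 4/3" if "d \<in> D" for d
  proof -
    have eq: "p d \<bullet> p d = (norm d / 2)\<^sup>2"
      by (simp add: p_def power_divide power2_norm_eq_inner)
    show "1 \<le> p d \<bullet> p d" unfolding eq using D(2)[OF that] power_mono[of 1 "norm d / 2" 2] by simp
    show "p d \<bullet> p d < 4/3" unfolding eq \<rho>[symmetric] using D(3)[OF that]
      by (intro power_strict_mono) auto
  qed
  note Sball = cap_cone_density(1)[OF reg p \<rho> \<open>0 < \<rho>\<close>, folded S_def]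
  have half: "norm x < dist x d \<longleftrightarrow> x \<bullet> p d < p d \<bullet> p d" for x d
    by (simp add: dist_greater_norm_iff p_def mult.commute)
  have outside: "x \<bullet> p d < p d \<bullet> p d" if "d \<in> D" "x \<in> ball 0 \<rho>" "x \<notin> cap_cone \<rho> (p d)" for x d
  proof -
    have "\<rho> * (x \<bullet> p d) \<le> (p d \<bullet> p d) * norm x" using that by (simp add: cap_cone_def)
    also have "\<dots> < (p d \<bullet> p d) * \<rho>" using that p[OF that(1)] by (intro mult_strict_left_mono) auto
    finally show ?thesis using \<open>0 < \<rho>\<close> by (simp add: mult.commute)
  qed
  have cones: "cap_cone \<rho> (p d) \<inter> cap_cone \<rho> (p e) = {}" if "d \<in> D" "e \<in> D" "d \<noteq> e" for d e
    unfolding p_def using that D \<rho> \<open>0 < \<rho>\<close> by (intro cap_cone_disjoint) auto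
  \<comment> \<open>A point in the cone of \<open>d\<close> is outside all other cones, so only the
    bisector of \<open>d\<close> can exclude it from the cell.\<close>
  have inside: "x \<in> origin_cell D \<longleftrightarrow> x \<in> S d"
    if "d \<in> D" "x \<in> ball 0 \<rho>" "x \<in> cap_cone \<rho> (p d)" for x d
  proof -
    have "x \<bullet> p e < p e \<bullet> p e" if "e \<in> D" "e \<noteq> d" for e
      using outside[OF that(1)] cones[of d e] that \<open>d \<in> D\<close> \<open>x \<in> ball 0 \<rho>\<close> \<open>x \<in> cap_cone \<rho> (p d)\<close> by blast
    then show ?thesis using that by (auto simp: origin_cell_def half S_def)
  qed
  have cell: "origin_cell D \<inter> B = (B - K) \<union> (\<Union>d\<in>D. S d \<inter> B)" if "B \<subseteq> ball 0 \<rho>" for B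
  proof (rule set_eqI)
    fix x
    show "x \<in> origin_cell D \<inter> B \<longleftrightarrow> x \<in> (B - K) \<union> (\<Union>d\<in>D. S d \<inter> B)"
    proof (cases "x \<in> B \<and> x \<in> K")
      case True
      then obtain d where d: "d \<in> D" "x \<in> cap_cone \<rho> (p d)" by (auto simp: K_def)
      have "x \<in> ball 0 \<rho>" using True that by auto
      have "x \<in> S e \<Longrightarrow> x \<in> S d" if "e \<in> D" for e
        using cones[OF d(1) that] d by (cases "e = d") (auto simp: S_def)
      then show ?thesis using inside[OF d(1) \<open>x \<in> ball 0 \<rho>\<close> d(2)] True d by auto
    next
      case False
      have "x \<in> origin_cell D" if "x \<in> B" "x \<notin> K"
        using that \<open>B \<subseteq> ball 0 \<rho>\<close> outside by (auto simp: origin_cell_def half K_def)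
      moreover have "x \<in> K" if "x \<in> S d" "d \<in> D" for d
        using that by (auto simp: S_def K_def)
      ultimately show ?thesis using False by auto
    qed
  qed
  have K: "K \<in> sets lebesgue"
    unfolding K_def using open_cap_cone by (intro sets_completionI_sets) (auto intro!: borel_open)
  have Sm: "S d \<in> sets lebesgue" for d
    unfolding S_def using open_cap_cone
    by (intro sets_completionI_sets) (auto intro!: borel_open open_Int open_Collect_less continuous_intros)
  have sum: "measure lebesgue (origin_cell D \<inter> B)
      = measure lebesgue (B - K) + (\<Sum>d\<in>D. measure lebesgue (S d \<inter> B))"
    if B: "B \<subseteq> ball 0 \<rho>" "B \<in> lmeasurable" for B
  proof -
    have SB: "S d \<inter> B \<in> lmeasurable" for d
      using fmeasurable_Int_fmeasurable[OF B(2) Sm] by (simp add: Int_commute)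
    have "measure lebesgue (\<Union>d\<in>D. S d \<inter> B) = (\<Sum>d\<in>D. measure lebesgue (S d \<inter> B))"
      using D(1) SB cones by (intro measure_UNION') (auto simp: pairwise_def disjnt_def S_def)
    moreover have "measure lebesgue ((B - K) \<union> (\<Union>d\<in>D. S d \<inter> B))
        = measure lebesgue (B - K) + measure lebesgue (\<Union>d\<in>D. S d \<inter> B)"
    proof (rule measure_Un_disjoint)
      show "B - K \<in> lmeasurable" "(\<Union>d\<in>D. S d \<inter> B) \<in> lmeasurable"
        by (rule fmeasurable_Diff[OF B(2) K], rule fmeasurable.finite_UN[OF D(1) SB])
    qed (auto simp: S_def K_def)
    ultimately show ?thesis unfolding cell[OF B(1)] by simp
  qed
  \<comment> \<open>The boundary circle is null, and the open disk is an exact scaled copy of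
    \<open>ball 0 \<rho>\<close>.\<close>
  have "measure lebesgue (cball 0 ?r - K) \<le> measure lebesgue (ball 0 ?r - K)"
  proof (rule measure_le_of_negligible_diff)
    show "cball 0 ?r - K \<in> sets lebesgue" "ball 0 ?r - K \<in> lmeasurable"
      using K by (auto intro: fmeasurable_Diff)
    show "negligible ((cball 0 ?r - K) - (ball 0 ?r - K))"
      by (rule negligible_subset[OF negligible_sphere[of 0 ?r]]) auto
  qed
  also have "ball 0 ?r - K = (\<lambda>x. (?r / \<rho>) *\<^sub>R x) ` (ball 0 \<rho> - K)"
  proof -
    define k where "k = ?r / \<rho>"
    have k: "0 < k" "?r = k * \<rho>" using l by (auto simp: k_def)
    \<comment> \<open>Both sides of the inequality defining \<open>cap_cone\<close> are homogeneous
      of degree one in \<open>x\<close>.\<close>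
    have mem: "k *\<^sub>R x \<in> K \<longleftrightarrow> x \<in> K" for x
    proof -
      have "k *\<^sub>R x \<in> cap_cone \<rho> q \<longleftrightarrow> k * ((q \<bullet> q) * norm x) < k * (\<rho> * (x \<bullet> q))" for q
        using k by (simp add: cap_cone_def mult_ac)
      then show ?thesis using k by (simp add: K_def cap_cone_def)
    qed
    have "x \<in> (\<lambda>x. k *\<^sub>R x) ` (ball 0 \<rho> - K)" if "x \<in> ball 0 ?r - K" for x
    proof (rule image_eqI)
      show "x = k *\<^sub>R ((1 / k) *\<^sub>R x)" using k by simp
      then show "(1 / k) *\<^sub>R x \<in> ball 0 \<rho> - K"
        using that mem[of "(1 / k) *\<^sub>R x"] k by (simp add: field_simps)
    qed
    moreover have "k *\<^sub>R x \<in> ball 0 ?r - K" if "x \<in> ball 0 \<rho> - K" for x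
      using that mem[of x] k(1) unfolding k(2) by simp
    ultimately show ?thesis unfolding k_def[symmetric] by blast
  qed
  also have "measure lebesgue \<dots> = ?r\<^sup>2 / (4/3) * measure lebesgue (ball 0 \<rho> - K)"
    by (simp add: measure_scaleR_plane power_divide \<rho>)
  also have "\<dots> \<le> ?\<sigma> * measure lebesgue (ball 0 \<rho> - K)"
    using sigma_bar_ge[OF reg l(1) \<open>?r\<^sup>2 \<le> 4/3\<close>] by (intro mult_right_mono) auto
  finally have 1: "measure lebesgue (cball 0 ?r - K) \<le> \<dots>" .
  \<comment> \<open>Since \<open>S d\<close> lies in \<open>ball 0 \<rho>\<close>, the intersection
    on the right is all of \<open>S d\<close>.\<close>
  have 2: "measure lebesgue (S d \<inter> cball 0 ?r) \<le> ?\<sigma> * measure lebesgue (S d \<inter> ball 0 \<rho>)" if "d \<in> D" for d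
    using cap_cone_density(2)[OF reg p[OF that] \<rho> \<open>0 < \<rho>\<close>, of l] Sball[OF that that]
    unfolding S_def by (simp add: Int_absorb2)
  have "measure lebesgue (origin_cell D \<inter> cball 0 ?r)
      = measure lebesgue (cball 0 ?r - K) + (\<Sum>d\<in>D. measure lebesgue (S d \<inter> cball 0 ?r))"
    using l by (intro sum) auto
  also have "\<dots> \<le> ?\<sigma> * measure lebesgue (ball 0 \<rho> - K) + (\<Sum>d\<in>D. ?\<sigma> * measure lebesgue (S d \<inter> ball 0 \<rho>))"
    using 1 2 by (intro add_mono sum_mono) auto
  also have "\<dots> = ?\<sigma> * measure lebesgue (origin_cell D \<inter> ball 0 \<rho>)"
    using sum[of "ball 0 \<rho>"] by (simp add: distrib_left sum_distrib_left)
  finally show ?thesis .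
qed

text \<open>Separation leaves finitely many centers in \<open>ball 0 (2 * \<rho>)\<close>, and only
  these affect the cell within radius \<open>\<rho>\<close>.\<close>

lemma origin_cell_density:
  assumes reg: "regular_triangle2 t1 t2 t3"
    and l: "0 \<le> l" "1 + l < \<rho>" and \<rho>: "\<rho>\<^sup>2 = 4/3"
    and D: "\<And>d. d \<in> D \<Longrightarrow> 2 \<le> norm d" "\<And>d e. d \<in> D \<Longrightarrow> e \<in> D \<Longrightarrow> d \<noteq> e \<Longrightarrow> 2 \<le> dist d e"
  shows "measure lebesgue (origin_cell D \<inter> cball 0 (1 + l))
      \<le> sigma_bar t1 t2 t3 l * measure lebesgue (origin_cell D \<inter> ball 0 \<rho>)"
    and "origin_cell D \<inter> cball 0 (1 + l) \<in> sets borel"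
    and "open (origin_cell D \<inter> ball 0 \<rho>)"
proof -
  let ?D = "D \<inter> ball 0 (2 * \<rho>)"
  have fin: "finite ?D"
    using D(2) by (intro finite_separated_bounded[of 2]) (auto intro: bounded_subset[OF bounded_ball])
  have "cball 0 (1 + l) \<subseteq> (ball 0 \<rho> :: (real^2) set)" using l by auto
  then have eq: "origin_cell D \<inter> cball 0 (1 + l) = origin_cell ?D \<inter> cball 0 (1 + l)"
    using origin_cell_Int_ball[of D \<rho>] by blast
  show "measure lebesgue (origin_cell D \<inter> cball 0 (1 + l))
      \<le> sigma_bar t1 t2 t3 l * measure lebesgue (origin_cell D \<inter> ball 0 \<rho>)"
    unfolding eq origin_cell_Int_ball[of D \<rho>]
    using fin D by (intro origin_cell_density_finite[OF reg l \<rho>]) auto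
  show "origin_cell D \<inter> cball 0 (1 + l) \<in> sets borel"
    unfolding eq using open_origin_cell[OF fin] by auto
  show "open (origin_cell D \<inter> ball 0 \<rho>)"
    unfolding origin_cell_Int_ball[of D \<rho>] using open_origin_cell[OF fin] by auto
qed

section \<open>The upper bound\<close>

lemma borel_imp_lebesgue: "S \<in> sets borel \<Longrightarrow> S \<in> sets lebesgue"
  by (simp add: sets_completionI_sets)

lemma unit_disk_packing_dist:
  assumes "unit_disk_packing c" "i \<noteq> j"
  shows "2 \<le> dist (c i) (c j)"
  using assms by (metis dist_commute dist_norm linorder_neqE_nat unit_disk_packing_def)

lemma finite_packing_centers:
  assumes "unit_disk_packing c"
  shows "finite {i. dist x (c i) \<le> M}"
proof -
  have "inj c" using unit_disk_packing_dist[OF assms] by (metis dist_self injI not_numeral_le_zero)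
  have "finite (c ` {i. dist x (c i) \<le> M})"
  proof (rule finite_separated_bounded[of 2])
    show "2 \<le> dist y z" if "y \<in> c ` {i. dist x (c i) \<le> M}" "z \<in> c ` {i. dist x (c i) \<le> M}" "y \<noteq> z" for y z
      using that by (auto intro!: unit_disk_packing_dist[OF assms])
    show "bounded (c ` {i. dist x (c i) \<le> M})"
      by (rule bounded_subset[OF bounded_cball[of x M]]) auto
  qed simp
  then show ?thesis using \<open>inj c\<close> finite_imageD inj_on_subset by blast
qed

lemma negligible_bisector:
  fixes a b :: "'a::euclidean_space"
  assumes "a \<noteq> b"
  shows "negligible {x. dist x a = dist x b}"
proof -
  have "dist x a = dist x b \<longleftrightarrow> (b - a) \<bullet> x = (b \<bullet> b - a \<bullet> a) / 2" for x
  proof -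
    have "dist x a = dist x b \<longleftrightarrow> (x - a) \<bullet> (x - a) = (x - b) \<bullet> (x - b)"
      by (simp add: dist_norm norm_eq_sqrt_inner)
    also have "\<dots> \<longleftrightarrow> 2 * ((b - a) \<bullet> x) = b \<bullet> b - a \<bullet> a"
      by (simp add: inner_diff_left inner_diff_right inner_commute) argo
    finally show ?thesis by argo
  qed
  then show ?thesis using assms by (simp only:) (intro negligible_hyperplane, simp)
qed

lemma borel_enlarged_union: "enlarged_union c l \<in> sets borel"
  unfolding enlarged_union_def by (intro sets.countable_UN) auto

text \<open>The sets \<open>U i\<close> cover the region up to bisectors, each has at most \<sigma>
  times the area of \<open>W i\<close>, and the \<open>W i\<close> are disjoint. The margin
  \<open>2 * \<rho>\<close> arises because the centers in \<open>I\<close> lie within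
  \<open>M + \<rho>\<close> of the origin and their truncated cells reach at most
  \<open>\<rho>\<close> further.\<close>

lemma area_enlarged_union_le:
  assumes reg: "regular_triangle2 t1 t2 t3" and pack: "unit_disk_packing c"
    and l: "0 \<le> l" "1 + l < \<rho>" and \<rho>: "\<rho>\<^sup>2 = 4/3"
  shows "area (enlarged_union c l \<inter> cball 0 M) \<le> sigma_bar t1 t2 t3 l * area (cball 0 (M + 2 * \<rho>))"
proof -
  let ?r = "1 + l" and ?\<sigma> = "sigma_bar t1 t2 t3 l"
  define I where "I = {i. dist 0 (c i) \<le> M + ?r}"
  define D where "D = (\<lambda>i. {c j - c i |j. j \<noteq> i})"
  define U where "U = (\<lambda>i. (+) (c i) ` (origin_cell (D i) \<inter> cball 0 ?r))"
  define W where "W = (\<lambda>i. (+) (c i) ` (origin_cell (D i) \<inter> ball 0 \<rho>))"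
  note sep = unit_disk_packing_dist[OF pack]
  have "finite I" unfolding I_def by (rule finite_packing_centers[OF pack])
  have D1: "2 \<le> norm d" if "d \<in> D i" for d i
    using that sep by (force simp: D_def dist_norm)
  have D2: "2 \<le> dist d e" if de: "d \<in> D i" "e \<in> D i" "d \<noteq> e" for d e i
  proof -
    obtain j k where "d = c j - c i" "e = c k - c i" using de by (auto simp: D_def)
    with de sep[of j k] show ?thesis by (auto simp: dist_norm)
  qed
  have cell: "measure lebesgue (origin_cell (D i) \<inter> cball 0 ?r)
      \<le> ?\<sigma> * measure lebesgue (origin_cell (D i) \<inter> ball 0 \<rho>)"
    "origin_cell (D i) \<inter> cball 0 ?r \<in> sets borel" "open (origin_cell (D i) \<inter> ball 0 \<rho>)" for i
    by (rule origin_cell_density[OF reg l \<rho>], erule D1, erule (2) D2)+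
  have Um0: "origin_cell (D i) \<inter> cball 0 ?r \<in> lmeasurable" for i
    by (rule fmeasurableI2[of "cball 0 ?r"]) (use borel_imp_lebesgue[OF cell(2)[of i]] in auto)
  have Wm0: "origin_cell (D i) \<inter> ball 0 \<rho> \<in> lmeasurable" for i
    using cell(3)[of i] by (intro lmeasurable_open bounded_subset[OF bounded_ball[of 0 \<rho>]]) auto
  have Um: "U i \<in> lmeasurable" and Wm: "W i \<in> lmeasurable" for i
    unfolding U_def W_def using Um0 Wm0 by (auto intro: measurable_translation)
  have UW: "measure lebesgue (U i) \<le> ?\<sigma> * measure lebesgue (W i)" for i
    unfolding U_def W_def measure_translation using cell(1)[of i] .
  have cellD: "dist x (c i) < dist x (c j)" if x: "x \<in> (+) (c i) ` origin_cell (D i)" and "j \<noteq> i" for x i j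
  proof -
    obtain y where y: "x = c i + y" "y \<in> origin_cell (D i)" using x by blast
    have "norm y < dist y (c j - c i)" using y(2) that by (auto simp: origin_cell_def D_def)
    then show ?thesis unfolding y(1) by (simp add: dist_norm algebra_simps)
  qed
  have cellI: "x \<in> U i" if "\<And>j. j \<noteq> i \<Longrightarrow> dist x (c i) < dist x (c j)" "dist x (c i) \<le> ?r" for x i
    unfolding U_def
  proof (rule image_eqI)
    show "x = c i + (x - c i)" by simp
    show "x - c i \<in> origin_cell (D i) \<inter> cball 0 ?r"
      using that by (auto simp: origin_cell_def D_def dist_norm norm_minus_commute)
  qed
  \<comment> \<open>Points with several nearest centers belong to no open cell; they lie on
    countably many bisectors.\<close>
  define N where "N = (\<Union>i. \<Union>j\<in>-{i}. {x. dist x (c i) = dist x (c j)})"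
  have "negligible N"
  proof -
    have "negligible {x. dist x (c i) = dist x (c j)}" if "j \<noteq> i" for i j
      using sep[OF that] by (intro negligible_bisector) auto
    then have "negligible (\<Union>j\<in>-{i}. {x. dist x (c i) = dist x (c j)})" for i
      by (intro negligible_countable_Union) auto
    then show ?thesis unfolding N_def by (intro negligible_countable_Union) auto
  qed
  have cover: "enlarged_union c l \<inter> cball 0 M - (\<Union>i\<in>I. U i) \<subseteq> N"
  proof
    fix x assume x: "x \<in> enlarged_union c l \<inter> cball 0 M - (\<Union>i\<in>I. U i)"
    let ?J = "{j. dist x (c j) \<le> ?r}"
    have "finite ?J" by (rule finite_packing_centers[OF pack])
    moreover have "?J \<noteq> {}" using x by (auto simp: enlarged_union_def dist_commute)
    ultimately obtain i where i: "i \<in> ?J" "\<And>j. j \<in> ?J \<Longrightarrow> dist x (c i) \<le> dist x (c j)"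
      using ex_is_arg_min_if_finite[of ?J "\<lambda>j. dist x (c j)"] by (auto simp: is_arg_min_linorder)
    \<comment> \<open>A center outside \<open>?J\<close> is farther than \<open>?r\<close> from
      \<open>x\<close>, hence farther than the nearest one in \<open>?J\<close>.\<close>
    have le: "dist x (c i) \<le> dist x (c j)" for j using i by (cases "j \<in> ?J") auto
    have "dist 0 (c i) \<le> M + ?r" using x i dist_triangle[of 0 "c i" x] by auto
    then have "x \<notin> U i" using x by (auto simp: I_def)
    then obtain j where "j \<noteq> i" "\<not> dist x (c i) < dist x (c j)" using cellI[of i x] i by auto
    then have "dist x (c i) = dist x (c j)" using le[of j] by simp
    then show "x \<in> N" using \<open>j \<noteq> i\<close> by (auto simp: N_def)
  qed
  have "0 \<le> ?\<sigma>" by (simp add: sigma_bar_def)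
  have "area (enlarged_union c l \<inter> cball 0 M) \<le> area (\<Union>i\<in>I. U i)"
    using \<open>finite I\<close> Um borel_enlarged_union[of c l]
    by (intro measure_le_of_negligible_diff negligible_subset[OF \<open>negligible N\<close> cover])
       (auto intro!: fmeasurable.finite_UN borel_imp_lebesgue)
  also have "\<dots> \<le> (\<Sum>i\<in>I. area (U i))"
    using \<open>finite I\<close> Um by (intro measure_UNION_le) auto
  also have "\<dots> \<le> ?\<sigma> * (\<Sum>i\<in>I. area (W i))"
    unfolding sum_distrib_left by (intro sum_mono UW)
  also have "(\<Sum>i\<in>I. area (W i)) = area (\<Union>i\<in>I. W i)"
  proof -
    \<comment> \<open>A common point would be strictly nearer to each of the two centers than to the
      other.\<close>
    have "W i \<inter> W j = {}" if "i \<noteq> j" for i j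
      using cellD[of _ i j] cellD[of _ j i] that unfolding W_def by (force simp: image_iff)
    then show ?thesis
      using \<open>finite I\<close> Wm by (intro measure_UNION'[symmetric]) (auto simp: pairwise_def disjnt_def)
  qed
  also have "?\<sigma> * area (\<Union>i\<in>I. W i) \<le> ?\<sigma> * area (cball 0 (M + 2 * \<rho>))"
  proof (intro mult_left_mono measure_mono_fmeasurable)
    show "(\<Union>i\<in>I. W i) \<subseteq> cball 0 (M + 2 * \<rho>)"
    proof
      fix x assume "x \<in> (\<Union>i\<in>I. W i)"
      then obtain i y where "i \<in> I" "x = c i + y" "norm y < \<rho>" unfolding W_def by fastforce
      then show "x \<in> cball 0 (M + 2 * \<rho>)"
        using norm_triangle_ineq[of "c i" y] l by (auto simp: I_def)
    qed
  qed (use \<open>finite I\<close> Wm \<open>0 \<le> ?\<sigma>\<close> in auto)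
  finally show ?thesis .
qed

section \<open>From area estimates in disks to upper densities\<close>

lemma area_cball_plane:
  assumes "0 \<le> R"
  shows "area (cball (0::real^2) R) = pi * R\<^sup>2"
proof -
  have "area (cball (0::real^2) R) = measure lborel (cball (0::real^2) R)" by simp
  also have "\<dots> = pi * R\<^sup>2"
    using assms by (subst content_cball) (simp_all add: unit_ball_vol_2)
  finally show ?thesis .
qed

lemma tendsto_rescaled_square:
  "((\<lambda>R::real. ereal (s * (1 + K / R)\<^sup>2)) \<longlongrightarrow> ereal s) at_top"
proof -
  have "((\<lambda>R. K / R) \<longlongrightarrow> 0) at_top"
    by (intro real_tendsto_divide_at_top[OF tendsto_const] filterlim_ident)
  then have "((\<lambda>R::real. s * (1 + K / R)\<^sup>2) \<longlongrightarrow> s * (1 + 0)\<^sup>2) at_top"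
    by (intro tendsto_intros)
  then show ?thesis by simp
qed

lemma area_cball_ratio:
  assumes "0 < R" "0 \<le> R + K"
  shows "s * area (cball (0::real^2) (R + K)) / area (cball (0::real^2) R) = s * (1 + K / R)\<^sup>2"
proof -
  have "1 + K / R = (R + K) / R" using assms by (simp add: field_simps)
  then show ?thesis
    unfolding area_cball_plane[OF assms(2)] area_cball_plane[OF less_imp_le[OF assms(1)]]
    by (simp add: power_divide)
qed

text \<open>A constant change of the radius multiplies the area of the disk by
  \<open>(1 + K / R)\<^sup>2\<close>, which tends to 1, so boundary effects vanish in the
  limit.\<close>

lemma upper_density_leI:
  assumes "\<And>R. area (S \<inter> cball 0 R) \<le> s * area (cball (0::real^2) (R + K))" "0 \<le> K"
  shows "upper_density S \<le> ereal s"
proof -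
  have "upper_density S \<le> Limsup at_top (\<lambda>R::real. ereal (s * (1 + K / R)\<^sup>2))"
    unfolding upper_density_def
  proof (intro Limsup_mono eventually_mono[OF eventually_gt_at_top[of 0]])
    fix R :: real assume "0 < R"
    then show "ereal (area (S \<inter> cball 0 R) / area (cball 0 R)) \<le> ereal (s * (1 + K / R)\<^sup>2)"
      using divide_right_mono[OF assms(1)[of R], of "area (cball (0::real^2) R)"] area_cball_ratio[of R K s] assms(2)
      by (simp only: ereal_less_eq add_nonneg_nonneg less_imp_le measure_nonneg)
  qed
  also have "\<dots> = ereal s" by (intro lim_imp_Limsup tendsto_rescaled_square) simp
  finally show ?thesis .
qed

lemma upper_density_geI:
  assumes "\<And>R. s * area (cball (0::real^2) (R - K)) \<le> area (S \<inter> cball 0 R)" "0 \<le> K"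
  shows "ereal s \<le> upper_density S"
proof -
  have "ereal s = Limsup at_top (\<lambda>R::real. ereal (s * (1 + (- K) / R)\<^sup>2))"
    using lim_imp_Limsup[OF _ tendsto_rescaled_square[of s "- K"]] by simp
  also have "\<dots> \<le> upper_density S"
    unfolding upper_density_def
  \<comment> \<open>For \<open>R < K\<close> the disk of radius \<open>R - K\<close> is empty and
    the area formula fails, so the comparison starts beyond \<open>K\<close>.\<close>
  proof (intro Limsup_mono eventually_mono[OF eventually_gt_at_top[of K]])
    fix R :: real assume "K < R"
    then show "ereal (s * (1 + (- K) / R)\<^sup>2) \<le> ereal (area (S \<inter> cball 0 R) / area (cball 0 R))"
      using divide_right_mono[OF assms(1)[of R], of "area (cball (0::real^2) R)"] area_cball_ratio[of R "- K" s] assms(2)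
      unfolding diff_conv_add_uminus ereal_less_eq by force
  qed
  finally show ?thesis .
qed

section \<open>The lattice packing\<close>

text \<open>Four times this form, which is also the squared length of a lattice vector, is
  \<open>(2 * m + n)\<^sup>2 + 3 * n\<^sup>2\<close>. It is positive, and integrality raises
  positive to at least 1.\<close>

lemma sum_squares_hexagonal_ge_1:
  fixes m n :: int
  assumes "m \<noteq> 0 \<or> n \<noteq> 0"
  shows "1 \<le> m\<^sup>2 + m * n + n\<^sup>2"
proof -
  have "4 * (m\<^sup>2 + m * n + n\<^sup>2) = (2 * m + n)\<^sup>2 + 3 * n\<^sup>2" by (simp add: power2_eq_square algebra_simps)
  also have "\<dots> > 0" using assms by (cases "n = 0") (auto intro: add_nonneg_pos)
  finally show ?thesis by simp
qed

locale regular_triangle_lattice =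
  fixes t1 t2 t3 :: "real^2"
  assumes reg: "regular_triangle2 t1 t2 t3"
begin

definition u where "u = t2 - t1"
definition v where "v = t3 - t1"
definition pt :: "int \<Rightarrow> int \<Rightarrow> real^2" where "pt m n = t1 + of_int m *\<^sub>R u + of_int n *\<^sub>R v"

text \<open>A packing is a sequence, so the lattice points are enumerated through the bijections of
  \<open>nat\<close> with pairs and with \<open>int\<close>.\<close>

definition center :: "nat \<Rightarrow> real^2" where
  "center k = (case map_prod int_decode int_decode (prod_decode k) of (m, n) \<Rightarrow> pt m n)"

text \<open>The coordinates with respect to the origin \<open>t1\<close> and the basis \<open>u\<close>, \<open>v\<close>.\<close>

definition \<alpha> where "\<alpha> x = ((x - t1) \<bullet> (2 *\<^sub>R u - v)) / 6"
definition \<beta> where "\<beta> x = ((x - t1) \<bullet> (2 *\<^sub>R v - u)) / 6"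

lemma uv: "u \<bullet> u = 4" "v \<bullet> v = 4" "u \<bullet> v = 2" "v \<bullet> u = 2"
  using regular_triangle2_inner[OF reg] by (simp_all add: u_def v_def inner_commute)

lemma vertex_pt:
  assumes "t \<in> {t1, t2, t3}"
  obtains i j where "t = pt i j"
proof -
  have "t1 = pt 0 0" "t2 = pt 1 0" "t3 = pt 0 1" by (simp_all add: pt_def u_def v_def)
  then show ?thesis using assms that by blast
qed

text \<open>This serves the point reflection taking \<open>x\<close> to \<open>t2 + t3 - x\<close>,
  which exchanges the two triangles of the fundamental parallelogram.\<close>

lemma sum_vertices: "t2 + t3 = t1 + u + (t1 + v)"
  by (simp add: u_def v_def)

lemma pt_in_range_center: "pt m n \<in> range center"
proof -
  have "center (prod_encode (int_encode m, int_encode n)) = pt m n" by (simp add: center_def)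
  then show ?thesis by (metis rangeI)
qed

lemma pt_dist:
  assumes "(m, n) \<noteq> (m', n')"
  shows "2 \<le> dist (pt m n) (pt m' n')"
proof -
  define i j where "i = m - m'" and "j = n - n'"
  have "1 \<le> i\<^sup>2 + i * j + j\<^sup>2"
    using assms by (intro sum_squares_hexagonal_ge_1) (auto simp: i_def j_def)
  then have "(1::real) \<le> of_int (i\<^sup>2 + i * j + j\<^sup>2)" by (simp only: of_int_1_le_iff)
  moreover have "pt m n - pt m' n' = of_int i *\<^sub>R u + of_int j *\<^sub>R v"
    by (simp add: pt_def i_def j_def algebra_simps)
  then have "(dist (pt m n) (pt m' n'))\<^sup>2 = 4 * of_int (i\<^sup>2 + i * j + j\<^sup>2)"
    using uv unfolding dist_norm power2_norm_eq_inner
    by (simp add: inner_add_left inner_add_right power2_eq_square algebra_simps)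
  ultimately show ?thesis by (intro power2_le_imp_le[of 2]) auto
qed

lemma unit_disk_packing_center: "unit_disk_packing center"
  unfolding unit_disk_packing_def
proof (intro allI impI)
  fix j k :: nat assume "j < k"
  have "inj (\<lambda>k. map_prod int_decode int_decode (prod_decode k))"
    using inj_compose[OF prod.inj_map[OF inj_int_decode inj_int_decode] inj_prod_decode]
    by (simp add: o_def)
  then have "map_prod int_decode int_decode (prod_decode j) \<noteq> map_prod int_decode int_decode (prod_decode k)"
    using \<open>j < k\<close> by (metis injD nat_less_le)
  then show "2 \<le> norm (center j - center k)"
    using pt_dist unfolding center_def dist_norm by (auto split: prod.splits)
qed

text \<open>The vectors in \<alpha> and \<beta>, divided by 6, are the dual basis of
  \<open>u\<close>, \<open>v\<close>. The expansion is first taken in the orthogonal pair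
  \<open>u\<close>, \<open>2 *\<^sub>R v - u\<close>.\<close>

lemma coordinates: "x = t1 + \<alpha> x *\<^sub>R u + \<beta> x *\<^sub>R v"
proof -
  define w where "w = 2 *\<^sub>R v - u"
  have w: "u \<bullet> w = 0" "w \<bullet> w = 12"
    using uv by (simp_all add: w_def inner_diff_left inner_diff_right)
  then have "u \<noteq> 0" "w \<noteq> 0" using uv by auto
  define y where "y = x - t1"
  define p q where "p = y \<bullet> u / 4" and "q = y \<bullet> w / 12"
  have "y = p *\<^sub>R u + q *\<^sub>R w"
    using orthogonal_expansion_plane[OF w(1) \<open>u \<noteq> 0\<close> \<open>w \<noteq> 0\<close>, of y] uv w by (simp add: p_def q_def)
  also have "\<dots> = (p - q) *\<^sub>R u + (2 * q) *\<^sub>R v"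
    by (simp add: w_def algebra_simps)
  also have "p - q = \<alpha> x"
    by (simp add: p_def q_def \<alpha>_def y_def[symmetric] w_def inner_diff_right field_simps)
  also have "2 * q = \<beta> x" by (simp add: \<beta>_def q_def y_def w_def)
  finally show ?thesis by (simp add: y_def algebra_simps)
qed

lemma coordinates_eq: "\<alpha> (t1 + a *\<^sub>R u + b *\<^sub>R v) = a" "\<beta> (t1 + a *\<^sub>R u + b *\<^sub>R v) = b"
  using uv by (simp_all add: \<alpha>_def \<beta>_def inner_add_left inner_diff_right)

lemma coordinates_continuous [continuous_intros]: "continuous_on S \<alpha>" "continuous_on S \<beta>"
  unfolding \<alpha>_def \<beta>_def by (intro continuous_intros; simp)+

text \<open>A half-open fundamental parallelogram with corner \<open>pt m n\<close>; the floors make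
  the tiles a partition of the plane.\<close>

definition tile :: "int \<Rightarrow> int \<Rightarrow> (real^2) set" where
  "tile m n = {x. \<lfloor>\<alpha> x\<rfloor> = m \<and> \<lfloor>\<beta> x\<rfloor> = n}"

lemma tile_borel: "tile m n \<in> sets borel"
proof -
  have [measurable]: "\<alpha> \<in> borel_measurable borel" "\<beta> \<in> borel_measurable borel"
    by (intro borel_measurable_continuous_onI continuous_intros)+
  have "{x \<in> space borel. \<lfloor>\<alpha> x\<rfloor> = m \<and> \<lfloor>\<beta> x\<rfloor> = n} \<in> sets borel" by measurable
  then show ?thesis by (simp add: tile_def)
qed

text \<open>Coordinates relative to the corner are at most 1 and \<open>u\<close>, \<open>v\<close>
  have length 2. This crude bound determines the margins 4 and 8 in
  \<open>area_enlarged_union_ge\<close>.\<close>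

lemma tile_dist:
  assumes "x \<in> tile m n"
  shows "dist x (pt m n) \<le> 4"
proof -
  have "x - pt m n = (\<alpha> x - of_int m) *\<^sub>R u + (\<beta> x - of_int n) *\<^sub>R v"
    by (subst coordinates[of x]) (simp add: pt_def algebra_simps)
  then have "dist x (pt m n) \<le> \<bar>\<alpha> x - of_int m\<bar> * norm u + \<bar>\<beta> x - of_int n\<bar> * norm v"
    by (metis dist_norm norm_scaleR norm_triangle_ineq)
  also have "\<dots> \<le> 1 * 2 + 1 * 2"
  proof -
    have "norm u = 2" "norm v = 2" using uv by (simp_all add: norm_eq_sqrt_inner)
    moreover have "\<bar>\<alpha> x - of_int m\<bar> \<le> 1" "\<bar>\<beta> x - of_int n\<bar> \<le> 1"
      using assms unfolding tile_def mem_Collect_eq floor_eq_iff by linarith+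
    ultimately show ?thesis by simp
  qed
  finally show ?thesis by simp
qed

lemma tile_lmeasurable: "tile m n \<in> lmeasurable"
proof (rule fmeasurableI2)
  show "tile m n \<subseteq> cball (pt m n) 4" using tile_dist by (auto simp: dist_commute)
qed (auto intro: borel_imp_lebesgue tile_borel)

lemma triangle_coordinates:
  "x \<in> convex hull {t1, t2, t3} \<longleftrightarrow> 0 \<le> \<alpha> x \<and> 0 \<le> \<beta> x \<and> \<alpha> x + \<beta> x \<le> 1"
proof
  assume "x \<in> convex hull {t1, t2, t3}"
  then show "0 \<le> \<alpha> x \<and> 0 \<le> \<beta> x \<and> \<alpha> x + \<beta> x \<le> 1"
    unfolding convex_hull_3_alt u_def[symmetric] v_def[symmetric] using coordinates_eq by auto
next
  assume "0 \<le> \<alpha> x \<and> 0 \<le> \<beta> x \<and> \<alpha> x + \<beta> x \<le> 1"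
  then show "x \<in> convex hull {t1, t2, t3}"
    unfolding convex_hull_3_alt u_def[symmetric] v_def[symmetric] using coordinates[of x] by blast
qed

lemma coordinates_translate:
  "\<alpha> (of_int m *\<^sub>R u + of_int n *\<^sub>R v + x) = of_int m + \<alpha> x"
  "\<beta> (of_int m *\<^sub>R u + of_int n *\<^sub>R v + x) = of_int n + \<beta> x"
  "\<alpha> (t2 + t3 + of_int m *\<^sub>R u + of_int n *\<^sub>R v - x) = of_int m + 1 - \<alpha> x"
  "\<beta> (t2 + t3 + of_int m *\<^sub>R u + of_int n *\<^sub>R v - x) = of_int n + 1 - \<beta> x"
proof -
  define a b where "a = \<alpha> x" and "b = \<beta> x"
  have x: "x = t1 + a *\<^sub>R u + b *\<^sub>R v" unfolding a_def b_def by (rule coordinates)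
  have 1: "of_int m *\<^sub>R u + of_int n *\<^sub>R v + x = t1 + (of_int m + a) *\<^sub>R u + (of_int n + b) *\<^sub>R v"
    unfolding x by (simp add: algebra_simps)
  then have 2: "t2 + t3 + of_int m *\<^sub>R u + of_int n *\<^sub>R v - x
      = t1 + (of_int m + 1 - a) *\<^sub>R u + (of_int n + 1 - b) *\<^sub>R v"
    unfolding sum_vertices x by (simp add: scaleR_left_distrib scaleR_left_diff_distrib)
  show "\<alpha> (of_int m *\<^sub>R u + of_int n *\<^sub>R v + x) = of_int m + \<alpha> x"
    "\<beta> (of_int m *\<^sub>R u + of_int n *\<^sub>R v + x) = of_int n + \<beta> x"
    "\<alpha> (t2 + t3 + of_int m *\<^sub>R u + of_int n *\<^sub>R v - x) = of_int m + 1 - \<alpha> x"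
    "\<beta> (t2 + t3 + of_int m *\<^sub>R u + of_int n *\<^sub>R v - x) = of_int n + 1 - \<beta> x"
    unfolding 1 2 coordinates_eq a_def b_def by simp_all
qed

section \<open>Areas within a fundamental parallelogram\<close>

lemma area_reflect:
  fixes S :: "(real^2) set"
  shows "area ((\<lambda>x. s - x) ` S) = area S"
proof -
  have "(\<lambda>x. s - x) ` S = (+) s ` ((\<lambda>x. (-1) *\<^sub>R x) ` S)" by (auto simp: image_image)
  then show ?thesis by (simp only: measure_translation measure_scaleR_plane) simp
qed

text \<open>A diagonal cuts the tile into parts of a translated and of a reflected copy of the
  triangle, each of area \<open>sqrt 3\<close>.\<close>

lemma area_tile_le: "area (tile m n) \<le> 2 * sqrt 3"
proof -
  let ?T = "convex hull {t1, t2, t3}"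
  let ?a = "of_int m *\<^sub>R u + of_int n *\<^sub>R v" and ?s = "t2 + t3 + of_int m *\<^sub>R u + of_int n *\<^sub>R v"
  have "compact ?T" by (simp add: compact_convex_hull)
  then have cpt: "compact ((+) ?a ` ?T)" "compact ((\<lambda>x. ?s - x) ` ?T)"
    by (intro compact_translation compact_continuous_image continuous_intros; simp)+
  have "tile m n \<subseteq> (+) ?a ` ?T \<union> (\<lambda>x. ?s - x) ` ?T"
  proof
    fix x assume x: "x \<in> tile m n"
    have fl: "of_int m \<le> \<alpha> x" "\<alpha> x < of_int m + 1" "of_int n \<le> \<beta> x" "\<beta> x < of_int n + 1"
      using x by (auto simp: tile_def)
    show "x \<in> (+) ?a ` ?T \<union> (\<lambda>x. ?s - x) ` ?T"
    proof (cases "\<alpha> x + \<beta> x \<le> of_int m + of_int n + 1")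
      case True
      have "x - ?a \<in> ?T"
        using coordinates_translate(1,2)[of m n "x - ?a"] True fl unfolding triangle_coordinates by simp
      then have "x \<in> (+) ?a ` ?T" by (rule rev_image_eqI) simp
      then show ?thesis ..
    next
      case False
      have "?s - x \<in> ?T"
        using coordinates_translate(3,4)[of m n x] False fl unfolding triangle_coordinates by simp
      then have "x \<in> (\<lambda>x. ?s - x) ` ?T" by (rule rev_image_eqI) simp
      then show ?thesis ..
    qed
  qed
  then have "area (tile m n) \<le> area ((+) ?a ` ?T \<union> (\<lambda>x. ?s - x) ` ?T)"
    using tile_borel cpt by (intro measure_mono_fmeasurable fmeasurable.Un lmeasurable_compact borel_imp_lebesgue) auto
  also have "\<dots> \<le> area ((+) ?a ` ?T) + area ((\<lambda>x. ?s - x) ` ?T)"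
    using cpt by (intro measure_Un_le fmeasurableD lmeasurable_compact)
  also have "\<dots> = 2 * sqrt 3"
    by (simp only: measure_translation area_reflect measure_regular_triangle2[OF reg])
  finally show ?thesis .
qed

text \<open>The same two copies, now of the open triangle, are disjoint and lie in the tile. Their
  vertices are lattice points, so the part of the triangle near its vertices is carried into the
  enlarged disks. Passing to the interior in \<open>X\<close> loses only a null set.\<close>

lemma area_tile_Int_ge: "sigma_bar t1 t2 t3 l * (2 * sqrt 3) \<le> area (tile m n \<inter> enlarged_union center l)"
proof -
  let ?T = "convex hull {t1, t2, t3}"
  let ?B = "\<Union>t\<in>{t1, t2, t3}. cball t (1 + l)"
  let ?a = "of_int m *\<^sub>R u + of_int n *\<^sub>R v" and ?s = "t2 + t3 + of_int m *\<^sub>R u + of_int n *\<^sub>R v"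
  define X where "X = {x. 0 < \<alpha> x \<and> 0 < \<beta> x \<and> \<alpha> x + \<beta> x < 1} \<inter> ?B"
  have TB: "?T \<inter> ?B \<in> lmeasurable"
    by (intro fmeasurable.Int fmeasurable.finite_UN lmeasurable_compact compact_convex_hull) auto
  have null: "negligible (?T \<inter> ?B - X \<union> (X - ?T \<inter> ?B))"
  proof -
    have ne: "2 *\<^sub>R u - v \<noteq> 0" "2 *\<^sub>R v - u \<noteq> 0" "u + v \<noteq> 0"
    proof -
      have "(2 *\<^sub>R u - v) \<bullet> u = 6" "(2 *\<^sub>R v - u) \<bullet> v = 6" "(u + v) \<bullet> u = 6"
        using uv by (simp_all add: inner_diff_left inner_add_left)
      then show "2 *\<^sub>R u - v \<noteq> 0" "2 *\<^sub>R v - u \<noteq> 0" "u + v \<noteq> 0" by auto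
    qed
    have "\<alpha> x = ((2 *\<^sub>R u - v) \<bullet> x - (2 *\<^sub>R u - v) \<bullet> t1) / 6"
      "\<beta> x = ((2 *\<^sub>R v - u) \<bullet> x - (2 *\<^sub>R v - u) \<bullet> t1) / 6"
      "\<alpha> x + \<beta> x = ((u + v) \<bullet> x - (u + v) \<bullet> t1) / 6" for x
      by (simp_all add: \<alpha>_def \<beta>_def inner_diff_left inner_diff_right inner_add_left inner_add_right
        inner_commute field_simps)
    then have eqs: "\<alpha> x = 0 \<longleftrightarrow> (2 *\<^sub>R u - v) \<bullet> x = (2 *\<^sub>R u - v) \<bullet> t1"
      "\<beta> x = 0 \<longleftrightarrow> (2 *\<^sub>R v - u) \<bullet> x = (2 *\<^sub>R v - u) \<bullet> t1"
      "\<alpha> x + \<beta> x = 1 \<longleftrightarrow> (u + v) \<bullet> x = (u + v) \<bullet> t1 + 6" for x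
      by (simp only:, argo)+
    have "?T \<inter> ?B - X \<union> (X - ?T \<inter> ?B) \<subseteq> {x. \<alpha> x = 0} \<union> {x. \<beta> x = 0} \<union> {x. \<alpha> x + \<beta> x = 1}"
      by (intro subsetI, unfold X_def Un_iff Diff_iff Int_iff mem_Collect_eq triangle_coordinates) argo
    then show ?thesis
      by (rule negligible_subset[rotated]) (use ne in \<open>simp add: eqs negligible_hyperplane\<close>)
  qed
  have "area X = area (?T \<inter> ?B)" by (rule measure_negligible_symdiff[OF TB null])
  also have "\<dots> = sigma_bar t1 t2 t3 l * sqrt 3"
    by (simp add: sigma_bar_def measure_regular_triangle2[OF reg])
  finally have areaX: "area X = sigma_bar t1 t2 t3 l * sqrt 3" .
  have X: "X \<in> lmeasurable" using lmeasurable_negligible_symdiff[OF TB null] .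
  have X': "(+) ?a ` X \<in> lmeasurable" "(\<lambda>x. ?s - x) ` X \<in> lmeasurable"
  proof -
    have "(\<lambda>x. ?s - x) ` X = (+) ?s ` ((\<lambda>x. - x) ` X)" by (auto simp: image_image)
    moreover have "linear (\<lambda>x::real^2. - x)" by (intro linearI) auto
    ultimately show "(\<lambda>x. ?s - x) ` X \<in> lmeasurable"
      using X by (simp add: measurable_translation measurable_linear_image)
  qed (intro measurable_translation X)
  have disj: "(+) ?a ` X \<inter> (\<lambda>x. ?s - x) ` X = {}"
  proof -
    \<comment> \<open>The two copies lie strictly on opposite sides of the diagonal of the
      tile.\<close>
    have lt: "\<alpha> (?a + x) + \<beta> (?a + x) < of_int m + of_int n + 1" if "x \<in> X" for x
      using that unfolding coordinates_translate by (simp add: X_def)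
    have gt: "of_int m + of_int n + 1 < \<alpha> (?s - x) + \<beta> (?s - x)" if "x \<in> X" for x
      using that unfolding coordinates_translate by (simp add: X_def)
    show ?thesis
    proof (rule equals0I)
      fix z assume z: "z \<in> (+) ?a ` X \<inter> (\<lambda>x. ?s - x) ` X"
      obtain x y where x: "x \<in> X" "z = ?a + x" and y: "y \<in> X" "z = ?s - y" using z by blast
      show False using lt[OF x(1)] gt[OF y(1)] unfolding x(2)[symmetric] y(2)[symmetric] by linarith
    qed
  qed
  have "(+) ?a ` X \<subseteq> tile m n \<inter> enlarged_union center l"
  proof (rule image_subsetI)
    fix x assume x: "x \<in> X"
    then have "x \<in> ?B" by (simp only: X_def Int_iff)
    then obtain t where t: "t \<in> {t1, t2, t3}" "x \<in> cball t (1 + l)" by (rule UN_E)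
    obtain i j where "t = pt i j" using vertex_pt[OF t(1)] by blast
    then have ij: "dist (pt i j) x \<le> 1 + l" using t(2) by simp
    \<comment> \<open>Translation by a lattice vector takes vertices to lattice points.\<close>
    have "pt (m + i) (n + j) = ?a + pt i j" by (simp add: pt_def algebra_simps)
    then have "?a + x \<in> cball (pt (m + i) (n + j)) (1 + l)" using ij by (simp add: dist_norm)
    then have "?a + x \<in> enlarged_union center l" using pt_in_range_center[of "m + i" "n + j"] by (auto simp: enlarged_union_def)
    moreover have "?a + x \<in> tile m n"
      using x unfolding tile_def mem_Collect_eq coordinates_translate by (auto simp: X_def floor_eq_iff)
    ultimately show "?a + x \<in> tile m n \<inter> enlarged_union center l" by blast
  qed
  moreover have "(\<lambda>x. ?s - x) ` X \<subseteq> tile m n \<inter> enlarged_union center l"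
  proof (rule image_subsetI)
    fix x assume x: "x \<in> X"
    then have "x \<in> ?B" by (simp only: X_def Int_iff)
    then obtain t where t: "t \<in> {t1, t2, t3}" "x \<in> cball t (1 + l)" by (rule UN_E)
    obtain i j where "t = pt i j" using vertex_pt[OF t(1)] by blast
    then have ij: "dist (pt i j) x \<le> 1 + l" using t(2) by simp
    \<comment> \<open>The reflection takes \<open>t1\<close> to the opposite corner of the tile,
      which explains the shift by 1.\<close>
    have "pt (m + 1 - i) (n + 1 - j) = ?s - pt i j"
      unfolding sum_vertices pt_def by (simp add: scaleR_left_distrib scaleR_left_diff_distrib)
    then have "?s - x \<in> cball (pt (m + 1 - i) (n + 1 - j)) (1 + l)"
      using ij by (simp add: dist_norm norm_minus_commute)
    then have "?s - x \<in> enlarged_union center l"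
      using pt_in_range_center[of "m + 1 - i" "n + 1 - j"] by (auto simp: enlarged_union_def)
    moreover have "?s - x \<in> tile m n"
      using x unfolding tile_def mem_Collect_eq coordinates_translate by (auto simp: X_def floor_eq_iff)
    ultimately show "?s - x \<in> tile m n \<inter> enlarged_union center l" by blast
  qed
  ultimately have "area ((+) ?a ` X \<union> (\<lambda>x. ?s - x) ` X) \<le> area (tile m n \<inter> enlarged_union center l)"
    using X' borel_enlarged_union[of center l]
    by (intro measure_mono_fmeasurable fmeasurable_Int_fmeasurable tile_lmeasurable) (auto intro: borel_imp_lebesgue)
  moreover have "area ((+) ?a ` X \<union> (\<lambda>x. ?s - x) ` X) = 2 * area X"
    unfolding measure_Un_disjoint[OF X' disj] by (simp only: measure_translation area_reflect)
  ultimately show ?thesis unfolding areaX by simp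
qed

text \<open>Tiles with corner within \<open>M - 4\<close> of the origin lie in
  \<open>cball 0 M\<close> and cover \<open>cball 0 (M - 8)\<close>. In each of them the covered
  area is at least \<sigma> times the tile's area.\<close>

lemma area_enlarged_union_ge:
  "sigma_bar t1 t2 t3 l * area (cball 0 (M - 8)) \<le> area (enlarged_union center l \<inter> cball 0 M)"
proof -
  let ?\<sigma> = "sigma_bar t1 t2 t3 l" and ?P = "enlarged_union center l"
  define J where "J = {(m, n). norm (pt m n) \<le> M - 4}"
  have "inj_on (\<lambda>(m, n). pt m n) J"
  proof (rule inj_onI)
    fix y z :: "int \<times> int" assume "(\<lambda>(m, n). pt m n) y = (\<lambda>(m, n). pt m n) z"
    then show "y = z" using pt_dist[of "fst y" "snd y" "fst z" "snd z"] by (cases y; cases z) auto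
  qed
  moreover have "finite ((\<lambda>(m, n). pt m n) ` J)"
  proof (rule finite_separated_bounded[of 2])
    show "bounded ((\<lambda>(m, n). pt m n) ` J)"
      by (rule bounded_subset[OF bounded_cball[of 0 "M - 4"]]) (auto simp: J_def)
    show "2 \<le> dist x y" if "x \<in> (\<lambda>(m, n). pt m n) ` J" "y \<in> (\<lambda>(m, n). pt m n) ` J" "x \<noteq> y" for x y
      using that by (auto intro!: pt_dist)
  qed simp
  ultimately have "finite J" by (rule finite_imageD[rotated])
  have "0 \<le> ?\<sigma>" by (simp add: sigma_bar_def)
  have "area (cball 0 (M - 8)) \<le> area (\<Union>(m, n)\<in>J. tile m n)"
  proof (rule measure_mono_fmeasurable)
    show "cball 0 (M - 8) \<subseteq> (\<Union>(m, n)\<in>J. tile m n)"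
    proof
      fix x assume x: "x \<in> cball (0::real^2) (M - 8)"
      have "x \<in> tile \<lfloor>\<alpha> x\<rfloor> \<lfloor>\<beta> x\<rfloor>" by (simp add: tile_def)
      moreover from tile_dist[OF this] have "(\<lfloor>\<alpha> x\<rfloor>, \<lfloor>\<beta> x\<rfloor>) \<in> J"
        using x norm_triangle_ineq3[of "pt \<lfloor>\<alpha> x\<rfloor> \<lfloor>\<beta> x\<rfloor>" x] by (simp add: J_def dist_norm norm_minus_commute)
      ultimately show "x \<in> (\<Union>(m, n)\<in>J. tile m n)" by blast
    qed
    show "(\<Union>(m, n)\<in>J. tile m n) \<in> lmeasurable"
      using \<open>finite J\<close> tile_lmeasurable by (intro fmeasurable.finite_UN) auto
  qed simp
  also have "\<dots> \<le> (\<Sum>(m, n)\<in>J. area (tile m n))"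
    using measure_UNION_le[OF \<open>finite J\<close>, of "\<lambda>(m, n). tile m n" lebesgue] tile_lmeasurable
    by (auto simp: case_prod_unfold)
  also have "\<dots> \<le> (\<Sum>(m, n)\<in>J. 2 * sqrt 3)"
    using area_tile_le by (intro sum_mono) auto
  finally have "?\<sigma> * area (cball 0 (M - 8)) \<le> ?\<sigma> * (\<Sum>(m, n)\<in>J. 2 * sqrt 3)"
    using \<open>0 \<le> ?\<sigma>\<close> by (rule mult_left_mono)
  also have "\<dots> \<le> (\<Sum>(m, n)\<in>J. area (tile m n \<inter> ?P))"
    unfolding sum_distrib_left using area_tile_Int_ge by (intro sum_mono) auto
  also have "\<dots> = area (\<Union>(m, n)\<in>J. tile m n \<inter> ?P)"
  proof -
    have "tile m n \<inter> ?P \<in> lmeasurable" for m n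
      using borel_enlarged_union[of center l]
      by (intro fmeasurable_Int_fmeasurable tile_lmeasurable) (auto intro: borel_imp_lebesgue)
    moreover have "pairwise (\<lambda>i j. disjnt (tile (fst i) (snd i) \<inter> ?P) (tile (fst j) (snd j) \<inter> ?P)) J"
      by (auto simp: pairwise_def disjnt_def tile_def)
    ultimately show ?thesis
      unfolding case_prod_unfold by (intro measure_UNION'[symmetric] \<open>finite J\<close>)
  qed
  also have "\<dots> \<le> area (?P \<inter> cball 0 M)"
  proof (rule measure_mono_fmeasurable)
    have "tile m n \<subseteq> cball 0 M" if "(m, n) \<in> J" for m n
    proof
      fix x assume "x \<in> tile m n"
      from tile_dist[OF this] show "x \<in> cball 0 M"
        using that norm_triangle_ineq2[of x "pt m n"] by (simp add: J_def dist_norm)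
    qed
    then show "(\<Union>(m, n)\<in>J. tile m n \<inter> ?P) \<subseteq> ?P \<inter> cball 0 M" by blast
    show "(\<Union>(m, n)\<in>J. tile m n \<inter> ?P) \<in> sets lebesgue"
      using \<open>finite J\<close> tile_borel borel_enlarged_union[of center l]
      by (intro sets.finite_UN) (auto intro!: borel_imp_lebesgue)
    show "?P \<inter> cball 0 M \<in> lmeasurable"
      using borel_enlarged_union[of center l] fmeasurable_Int_fmeasurable[of "cball 0 M" lebesgue ?P]
      by (auto simp: Int_commute intro: borel_imp_lebesgue)
  qed
  finally show ?thesis .
qed

end

theorem corollary1:
  fixes l :: real and t1 t2 t3 :: "real^2"
  assumes "regular_triangle2 t1 t2 t3"
    and "0 \<le> l" and "l < 2 / sqrt 3 - 1"
  shows "delta_bar l = ereal (sigma_bar t1 t2 t3 l)"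
proof (rule antisym)
  have "(2 / sqrt 3)\<^sup>2 = (4/3 :: real)" by (simp add: power_divide)
  \<comment> \<open>For \<rho> equal to \<open>2 / sqrt 3\<close>, the bound on \<open>l\<close>
    says that the enlarged disks have radius below \<rho>.\<close>
  then show "delta_bar l \<le> ereal (sigma_bar t1 t2 t3 l)"
    unfolding delta_bar_def using assms
    by (intro SUP_least upper_density_leI[where K = "2 * (2 / sqrt 3)"] area_enlarged_union_le) auto
next
  \<comment> \<open>The given triangle itself generates the extremal lattice.\<close>
  interpret regular_triangle_lattice t1 t2 t3
    by unfold_locales (rule assms)
  have "ereal (sigma_bar t1 t2 t3 l) \<le> upper_density (enlarged_union center l)"
    by (rule upper_density_geI[where K = 8, OF area_enlarged_union_ge]) simp
  also have "\<dots> \<le> delta_bar l"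
    unfolding delta_bar_def by (intro SUP_upper) (simp add: unit_disk_packing_center)
  finally show "ereal (sigma_bar t1 t2 t3 l) \<le> delta_bar l" .
qed

end
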